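(* Let $n\in\mathbb{N}$, $1\le p_1,p_2<\infty$, $0<r\le 1$, $\frac1{p_1}+\frac1{p_1'}=1$, and let $m:\mathbb{N}_0^n\to\mathbb{C}$. If $$s_{r}(m,p_1,p_2):=\sum_{\nu\in\mathbb{N}^n_0}|m(\nu)|^r\Vert \phi_\nu\Vert^r_{L^{p_2}(\mathbb{R}^n)}\Vert \phi_{\nu}\Vert^r_{L^{p_1'}(\mathbb{R}^n)}<\infty,$$ then the Hermite multiplier $T_m:L^{p_1}(\mathbb{R}^n)\to L^{p_2}(\mathbb{R}^n)$ (extends to an operator which) is $r$-nuclear. Consequently, when $p_1=p_2$, the nuclear trace of $T_m$ is given by $$\mathrm{Tr}(T_m)=\int_{\mathbb{R}^n}\sum_{\nu\in\mathbb{N}_0^n}m(\nu)\phi_\nu(x)^2\,dx=\sum_{\nu\in\mathbb{N}_0^n}m(\nu).$$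
   Context: $\mathbb{N}_0=\{0,1,2,\dots\}$. For $\nu\in\mathbb{N}_0^n$ the Hermite function $\phi_\nu$ on $\mathbb{R}^n$ is $\phi_\nu(x)=\prod_{j=1}^n\phi_{\nu_j}(x_j)$, with $\phi_{\nu_j}(x_j)=(2^{\nu_j}\nu_j!\sqrt{\pi})^{-1/2}H_{\nu_j}(x_j)e^{-x_j^2/2}$ and $H_{\nu_j}$ the Hermite polynomial of order $\nu_j$. For a function $m$ on $\mathbb{N}_0^n$, the Hermite multiplier with symbol $m$ is the operator $T_mf(x)=\sum_{\nu\in\mathbb{N}_0^n}m(\nu)\widehat f(\phi_\nu)\phi_\nu(x)$, with $\widehat f(\phi_\nu)=\int_{\mathbb{R}^n}f(x)\phi_\nu(x)\,dx$, initially considered on $f\in C_c^\infty(\mathbb{R}^n)$. For Banach spaces $E,F$ and $0<r\le1$, a linear operator $T:E\to F$ is $r$-nuclear if there exist sequences $(e_i')$ in the dual $E'$ and $(y_i)$ in $F$ with $Tf=\sum_i e_i'(f)y_i$ for all $f\in E$ and $\sum_i\Vert e_i'\Vert_{E'}^r\Vert y_i\Vert_F^r<\infty$. When $E=F$ has the approximation property (as $L^p$-spaces do), the nuclear trace of such a $T$ is $\mathrm{Tr}(T)=\sum_i e_i'(y_i)$, which does not depend on the chosen representation. *)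

theory Defs
  imports "HOL-Analysis.Analysis" "HOL-Probability.Essential_Supremum"
begin

section \<open>Hermite functions\<close>

text \<open>Physicists' Hermite polynomials, by the Rodrigues formula.\<close>

definition hermite_poly :: "nat \<Rightarrow> real \<Rightarrow> real" where
  "hermite_poly k t = (-1) ^ k * exp (t\<^sup>2) * (deriv ^^ k) (\<lambda>s. exp (- s\<^sup>2)) t"

definition hermite_fun1 :: "nat \<Rightarrow> real \<Rightarrow> real" where
  "hermite_fun1 k t =
     (2 ^ k * fact k * sqrt pi) powr (- 1 / 2) * hermite_poly k t * exp (- t\<^sup>2 / 2)"

definition hermite_fun :: "nat ^ 'n::finite \<Rightarrow> real ^ 'n \<Rightarrow> complex" where
  "hermite_fun \<nu> x = complex_of_real (\<Prod>j\<in>UNIV. hermite_fun1 (\<nu> $ j) (x $ j))"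

definition hermite_coeff :: "(real ^ 'n::finite \<Rightarrow> complex) \<Rightarrow> nat ^ 'n \<Rightarrow> complex" where
  "hermite_coeff f \<nu> = (LINT x|lborel. f x * hermite_fun \<nu> x)"

section \<open>Test functions\<close>

fun differentiable_upto :: "nat \<Rightarrow> ('a::real_normed_vector \<Rightarrow> 'b::real_normed_vector) \<Rightarrow> bool" where
  "differentiable_upto 0 f \<longleftrightarrow> continuous_on UNIV f"
| "differentiable_upto (Suc k) f \<longleftrightarrow>
     (\<forall>x. f differentiable (at x)) \<and>
     (\<forall>v. differentiable_upto k (\<lambda>x. frechet_derivative f (at x) v))"

definition test_functions :: "(real ^ 'n::finite \<Rightarrow> complex) set" where
  "test_functions = {f. (\<forall>k. differentiable_upto k f) \<and> compact (closure {x. f x \<noteq> 0})}"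

section \<open>Spaces of functions with a seminorm\<close>

text \<open>
  A Banach space of classes of functions, such as \<open>L\<^sup>p\<close>, is represented by the underlying
  functions together with the seminorm that induces the norm of the quotient; two functions
  are the same vector when the seminorm of their difference is 0. Operators, which take values
  in functions, are accordingly only required to be linear up to functions of seminorm 0.
\<close>

record 'a fun_space =
  vecs :: "('a \<Rightarrow> complex) set"
  vnorm :: "('a \<Rightarrow> complex) \<Rightarrow> real"

definition same_vec :: "'a fun_space \<Rightarrow> ('a \<Rightarrow> complex) \<Rightarrow> ('a \<Rightarrow> complex) \<Rightarrow> bool" where
  "same_vec E f g \<longleftrightarrow> vnorm E (\<lambda>x. f x - g x) = 0"

definition dual_space :: "'a fun_space \<Rightarrow> (('a \<Rightarrow> complex) \<Rightarrow> complex) set" where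
  "dual_space E = {l.
     (\<forall>f\<in>vecs E. \<forall>g\<in>vecs E. l (\<lambda>x. f x + g x) = l f + l g) \<and>
     (\<forall>c. \<forall>f\<in>vecs E. l (\<lambda>x. c * f x) = c * l f) \<and>
     (\<exists>C. \<forall>f\<in>vecs E. cmod (l f) \<le> C * vnorm E f)}"

definition dual_norm :: "'a fun_space \<Rightarrow> (('a \<Rightarrow> complex) \<Rightarrow> complex) \<Rightarrow> real" where
  "dual_norm E l = (SUP f\<in>{f\<in>vecs E. vnorm E f \<le> 1}. cmod (l f))"

definition linear_operator ::
  "'a fun_space \<Rightarrow> 'b fun_space \<Rightarrow> (('a \<Rightarrow> complex) \<Rightarrow> ('b \<Rightarrow> complex)) \<Rightarrow> bool" where
  "linear_operator E F T \<longleftrightarrow>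
     (\<forall>f\<in>vecs E. T f \<in> vecs F) \<and>
     (\<forall>f\<in>vecs E. \<forall>g\<in>vecs E. same_vec E f g \<longrightarrow> same_vec F (T f) (T g)) \<and>
     (\<forall>f\<in>vecs E. \<forall>g\<in>vecs E. same_vec F (T (\<lambda>x. f x + g x)) (\<lambda>y. T f y + T g y)) \<and>
     (\<forall>c. \<forall>f\<in>vecs E. same_vec F (T (\<lambda>x. c * f x)) (\<lambda>y. c * T f y))"

definition nuclear_rep ::
  "real \<Rightarrow> 'a fun_space \<Rightarrow> 'b fun_space \<Rightarrow> (('a \<Rightarrow> complex) \<Rightarrow> ('b \<Rightarrow> complex)) \<Rightarrow>
   (nat \<Rightarrow> ('a \<Rightarrow> complex) \<Rightarrow> complex) \<Rightarrow> (nat \<Rightarrow> 'b \<Rightarrow> complex) \<Rightarrow> bool" where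
  "nuclear_rep r E F T e y \<longleftrightarrow>
     (\<forall>i. e i \<in> dual_space E) \<and> (\<forall>i. y i \<in> vecs F) \<and>
     (\<forall>f\<in>vecs E. (\<lambda>k. vnorm F (\<lambda>x. T f x - (\<Sum>i<k. e i f * y i x))) \<longlonglongrightarrow> 0) \<and>
     summable (\<lambda>i. dual_norm E (e i) powr r * vnorm F (y i) powr r)"

definition r_nuclear ::
  "real \<Rightarrow> 'a fun_space \<Rightarrow> 'b fun_space \<Rightarrow> (('a \<Rightarrow> complex) \<Rightarrow> ('b \<Rightarrow> complex)) \<Rightarrow> bool" where
  "r_nuclear r E F T \<longleftrightarrow> linear_operator E F T \<and> (\<exists>e y. nuclear_rep r E F T e y)"

text \<open>
  The definite description is meaningful only if every representation of the operator gives
  the same sum, as is the case on spaces with the approximation property.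
\<close>

definition nuclear_trace ::
  "real \<Rightarrow> 'a fun_space \<Rightarrow> (('a \<Rightarrow> complex) \<Rightarrow> ('a \<Rightarrow> complex)) \<Rightarrow> complex" where
  "nuclear_trace r E T = (THE t. \<exists>e y. nuclear_rep r E E T e y \<and> (\<lambda>i. e i (y i)) sums t)"

section \<open>Lebesgue spaces, for exponents in $[1,\infty]$\<close>

definition Lp_carrier :: "ennreal \<Rightarrow> ('a::euclidean_space \<Rightarrow> complex) set" where
  "Lp_carrier p = {f \<in> borel_measurable lborel.
     (if p = \<infinity> then esssup lborel (\<lambda>x. ennreal (cmod (f x))) < \<infinity>
      else (\<integral>\<^sup>+x. ennreal (cmod (f x) powr enn2real p) \<partial>lborel) < \<infinity>)}"

text \<open>The value is the norm only for functions in \<open>Lp_carrier\<close>; elsewhere it is arbitrary.\<close>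

definition Lp_norm :: "ennreal \<Rightarrow> ('a::euclidean_space \<Rightarrow> complex) \<Rightarrow> real" where
  "Lp_norm p f =
     (if p = \<infinity> then enn2real (esssup lborel (\<lambda>x. ennreal (cmod (f x))))
      else enn2real (\<integral>\<^sup>+x. ennreal (cmod (f x) powr enn2real p) \<partial>lborel) powr (1 / enn2real p))"

definition Lp :: "ennreal \<Rightarrow> 'a::euclidean_space fun_space" where
  "Lp p = \<lparr>vecs = Lp_carrier p, vnorm = Lp_norm p\<rparr>"

section \<open>Hermite multipliers\<close>

definition hermite_multiplier ::
  "(nat ^ 'n::finite \<Rightarrow> complex) \<Rightarrow> (real ^ 'n \<Rightarrow> complex) \<Rightarrow> (real ^ 'n \<Rightarrow> complex)" where
  "hermite_multiplier m f x = (\<Sum>\<^sub>\<infinity>\<nu>. m \<nu> * hermite_coeff f \<nu> * hermite_fun \<nu> x)"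

text \<open>
  Equality in \<open>L\<^sup>p\<close> is equality almost everywhere. Summability is required explicitly because
  an unordered sum that does not converge has the value 0.
\<close>

definition extends_hermite_multiplier ::
  "(nat ^ 'n::finite \<Rightarrow> complex) \<Rightarrow> ((real ^ 'n \<Rightarrow> complex) \<Rightarrow> (real ^ 'n \<Rightarrow> complex)) \<Rightarrow> bool" where
  "extends_hermite_multiplier m T \<longleftrightarrow>
     (\<forall>f\<in>test_functions. AE x in lborel.
        (\<lambda>\<nu>. m \<nu> * hermite_coeff f \<nu> * hermite_fun \<nu> x) summable_on UNIV \<and>
        T f x = hermite_multiplier m f x)"

text \<open>The last argument is the exponent conjugate to \<open>p\<^sub>1\<close>. Hermite functions belong to every
  \<open>L\<^sup>p\<close>, so the norms below are genuine.\<close>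

definition hermite_s ::
  "real \<Rightarrow> (nat ^ 'n::finite \<Rightarrow> complex) \<Rightarrow> ennreal \<Rightarrow> ennreal \<Rightarrow> ennreal" where
  "hermite_s r m p\<^sub>2 q =
     (\<Sum>\<^sub>\<infinity>\<nu>. ennreal (cmod (m \<nu>) powr r * Lp_norm p\<^sub>2 (hermite_fun \<nu>) powr r
                                      * Lp_norm q (hermite_fun \<nu>) powr r))"

end

theory Submission
  imports Defs "HOL-Probability.Distributions"
begin

text \<open>
  The functionals \<open>f \<mapsto> m(\<nu>) f^(\<phi>\<^sub>\<nu>)\<close> and the functions \<open>\<phi>\<^sub>\<nu>\<close>, listed along an enumeration
  of the multi-indices, represent the multiplier: by Hoelder the functionals have norm at most
  \<open>|m(\<nu>)|\<close> times the conjugate norm of \<open>\<phi>\<^sub>\<nu>\<close>, and a series whose \<open>L\<^sup>p\<close> norms are summable converges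
  almost everywhere and in \<open>L\<^sup>p\<close>. For the trace, only the normalisation of the Hermite functions is
  needed, not their orthogonality: it makes the \<open>\<nu>\<close>-th term of the nuclear sum equal to \<open>m(\<nu>)\<close>.

  That all representations of an operator \<open>T\<close> have the same sum rests on contractions
  \<open>P = \<Sum>\<^sub>j l\<^sub>j(\<cdot>) u\<^sub>j\<close> of finite rank which nearly fix any given finite set of vectors: replacing \<open>y\<^sub>i\<close>
  by \<open>P y\<^sub>i\<close> changes \<open>\<Sum>\<^sub>i e\<^sub>i(y\<^sub>i)\<close> only a little and turns it into \<open>\<Sum>\<^sub>j l\<^sub>j(T u\<^sub>j)\<close>, which no longer
  refers to the representation.
\<close>

section \<open>Lebesgue spaces\<close>

text \<open>The delicate point is uniqueness of the nuclear sum: without it the definite description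
  in \<open>nuclear_trace\<close> determines no value. The contractions used for it are conditional
  expectations, averaging over finitely many sets of finite measure. Jensen's inequality bounds all
  of them by 1, however many vectors have to be nearly fixed. This uniform bound controls the tail
  of the nuclear series, where P is not close to the identity; closeness is demanded of the first N
  vectors only.

  For equal exponents, absolute convergence of the sum of m comes from Hoelder and the
  normalisation: 1 = \<integral> \<phi>^2 is at most the product of the two norms of \<phi>, so
  |m(\<nu>)| is at most |m(\<nu>)| times that product. The products have summable r-th powers, hence
  are summable because r \<le> 1.

  Vectors are functions, not classes, so identities between series hold almost everywhere. Infinite
  sums and real suprema have default values, so summability and boundedness are carried along
  explicitly.\<close>

lemma le_mult_limit:
  fixes A B X :: real
  assumes "\<And>a b. A < a \<Longrightarrow> B < b \<Longrightarrow> X \<le> a * b"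
  shows "X \<le> A * B"
proof (rule tendsto_lowerbound)
  have "((\<lambda>e. (A + e) * (B + e)) \<longlongrightarrow> (A + 0) * (B + 0)) (at_right 0)"
    by (intro tendsto_intros)
  then show "((\<lambda>e. (A + e) * (B + e)) \<longlongrightarrow> A * B) (at_right 0)" by simp
  show "\<forall>\<^sub>F e in at_right 0. X \<le> (A + e) * (B + e)"
    using assms by (auto simp: eventually_at_filter)
qed simp

text \<open>Convexity of t^p in tangent form at c: Young's inequality for the product of a and
  c^(p-1), multiplied by p, is this bound. It yields both Minkowski (through convexity) and
  Jensen.\<close>

lemma powr_tangent:
  fixes a c p :: real
  assumes "1 \<le> p" "0 \<le> a" "0 \<le> c"
  shows "c powr p + p * c powr (p - 1) * (a - c) \<le> a powr p"
\<comment> \<open>For p = 1 the conjugate exponent would be infinite, and for c = 0 the tangent is 0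
  since \<open>0 powr x = 0\<close>.\<close>
proof (cases "p = 1 \<or> c = 0")
  case True
  then show ?thesis using assms by auto
next
  case False
  then have p: "1 < p" and c: "0 < c" using assms by auto
  define q where "q = p / (p - 1)"
  have q: "1 < q" "1 / p + 1 / q = 1" using p by (auto simp: q_def field_simps)
  have "a * c powr (p - 1) \<le> a powr p / p + (c powr (p - 1)) powr q / q"
    by (rule Youngs_inequality) (use p q assms in auto)
  also have "(c powr (p - 1)) powr q = c powr p"
    using p by (simp add: powr_powr q_def)
  finally have "p * (a * c powr (p - 1)) \<le> p * (a powr p / p + c powr p / q)"
    using p by (intro mult_left_mono) auto
  also have "\<dots> = a powr p + (p - 1) * c powr p"
    using p by (simp add: q_def field_simps)
  finally have "p * (a * c powr (p - 1)) \<le> a powr p + (p - 1) * c powr p" .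
  moreover have "c powr (p - 1) * c = c powr p"
    using c by (simp add: powr_diff)
  ultimately show ?thesis by (simp add: algebra_simps)
qed

text \<open>Both points lie above the tangent at their mean c; averaging with weights s and t
  cancels the linear terms.\<close>

lemma powr_convex_combination:
  fixes s t x y p :: real
  assumes "1 \<le> p" "0 \<le> s" "0 \<le> t" "s + t = 1" "0 \<le> x" "0 \<le> y"
  shows "(s * x + t * y) powr p \<le> s * x powr p + t * y powr p"
proof -
  define c where "c = s * x + t * y"
  define d where "d = p * c powr (p - 1)"
  have "c \<ge> 0" using assms by (simp add: c_def)
  then have "c powr p + d * (x - c) \<le> x powr p" "c powr p + d * (y - c) \<le> y powr p"
    using assms powr_tangent unfolding d_def by auto
  then have "s * (c powr p + d * (x - c)) + t * (c powr p + d * (y - c)) \<le> s * x powr p + t * y powr p"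
    using assms by (intro add_mono mult_left_mono) auto
  moreover have "s * (c powr p + d * (x - c)) + t * (c powr p + d * (y - c)) =
      (s + t) * c powr p + d * (s * x + t * y - (s + t) * c)"
    by (simp add: algebra_simps)
  ultimately show ?thesis using assms by (simp add: c_def)
qed

lemma Lp_sel [simp]: "vecs (Lp q) = Lp_carrier q" "vnorm (Lp q) = Lp_norm q"
  by (simp_all add: Lp_def)

lemma Lp_carrier_measurable: "f \<in> Lp_carrier q \<Longrightarrow> f \<in> borel_measurable borel"
  by (simp add: Lp_carrier_def)

lemma Lp_norm_nonneg [simp]: "0 \<le> Lp_norm q f"
  by (simp add: Lp_norm_def)

section \<open>Minkowski's inequality and absolutely convergent series in L^p\<close>

context
  fixes p :: real
  assumes p1: "1 \<le> p"
begin

lemma Lp_carrier_real_iff: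
  "f \<in> Lp_carrier (ennreal p) \<longleftrightarrow>
     f \<in> borel_measurable borel \<and> integrable lborel (\<lambda>x. cmod (f x) powr p)"
  using p1 by (auto simp: Lp_carrier_def integrable_iff_bounded)

lemma Lp_norm_real:
  assumes "f \<in> borel_measurable borel"
  shows "Lp_norm (ennreal p) f = (LINT x|lborel. cmod (f x) powr p) powr (1 / p)"
  using p1 assms by (simp add: Lp_norm_def integral_eq_nn_integral)

lemma Lp_norm_powr:
  assumes "f \<in> borel_measurable borel"
  shows "Lp_norm (ennreal p) f powr p = (LINT x|lborel. cmod (f x) powr p)"
  using p1 assms by (simp add: Lp_norm_real powr_powr)

lemma Lp_nn_integral:
  assumes "f \<in> Lp_carrier (ennreal p)"
  shows "(\<integral>\<^sup>+x. ennreal (cmod (f x) powr p) \<partial>lborel) = ennreal (Lp_norm (ennreal p) f powr p)"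
  using assms by (simp add: Lp_carrier_real_iff Lp_norm_powr nn_integral_eq_integral)

text \<open>A bound on \<open>Lp_norm\<close> alone says little, since \<open>enn2real\<close> sends
  an infinite integral to 0. A bound on the nonnegative integral gives membership and the norm
  estimate together.\<close>

lemma Lp_leI:
  assumes [measurable]: "f \<in> borel_measurable borel" and "0 \<le> a"
    and le: "(\<integral>\<^sup>+x. ennreal (cmod (f x) powr p) \<partial>lborel) \<le> ennreal (a powr p)"
  shows "f \<in> Lp_carrier (ennreal p)" "Lp_norm (ennreal p) f \<le> a"
proof -
  show f: "f \<in> Lp_carrier (ennreal p)"
    using le p1 by (auto simp: Lp_carrier_def intro: le_less_trans)
  have "Lp_norm (ennreal p) f powr p \<le> a powr p"
    using le Lp_nn_integral[OF f] by (simp add: ennreal_le_iff)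
  then show "Lp_norm (ennreal p) f \<le> a"
    using p1 assms(2) by (meson Lp_norm_nonneg linorder_not_le powr_less_mono2 less_le_trans zero_less_one)
qed

lemma Lp_dominated:
  assumes "f \<in> borel_measurable borel" "g \<in> Lp_carrier (ennreal p)"
    and "AE x in lborel. cmod (f x) \<le> cmod (g x)"
  shows "f \<in> Lp_carrier (ennreal p)" "Lp_norm (ennreal p) f \<le> Lp_norm (ennreal p) g"
proof -
  have "(\<integral>\<^sup>+x. ennreal (cmod (f x) powr p) \<partial>lborel) \<le> (\<integral>\<^sup>+x. ennreal (cmod (g x) powr p) \<partial>lborel)"
    by (rule nn_integral_mono_AE)
      (use assms(3) p1 in \<open>auto elim!: eventually_mono intro!: ennreal_leI powr_mono2\<close>)
  also have "\<dots> = ennreal (Lp_norm (ennreal p) g powr p)"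
    by (rule Lp_nn_integral) fact
  finally show "f \<in> Lp_carrier (ennreal p)" "Lp_norm (ennreal p) f \<le> Lp_norm (ennreal p) g"
    using Lp_leI[OF assms(1) Lp_norm_nonneg] by blast+
qed

lemma Lp_norm_AE_0:
  assumes "f \<in> borel_measurable borel" "AE x in lborel. f x = 0"
  shows "Lp_norm (ennreal p) f = 0"
proof -
  have "(\<integral>\<^sup>+x. ennreal (cmod (f x) powr p) \<partial>lborel) = 0"
    using assms by (subst nn_integral_0_iff_AE) (auto elim!: eventually_mono)
  then have "Lp_norm (ennreal p) f \<le> 0"
    using assms(1) by (intro Lp_leI) auto
  then show ?thesis by (simp add: order_antisym)
qed

lemma Lp_zero: "(\<lambda>x. 0) \<in> Lp_carrier (ennreal p)"
  by (simp add: Lp_carrier_real_iff)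

lemma Lp_scale:
  assumes "f \<in> Lp_carrier (ennreal p)"
  shows "(\<lambda>x. c * f x) \<in> Lp_carrier (ennreal p)"
    "Lp_norm (ennreal p) (\<lambda>x. c * f x) = cmod c * Lp_norm (ennreal p) f"
proof -
  have [measurable]: "f \<in> borel_measurable borel" using assms by (simp add: Lp_carrier_real_iff)
  have *: "(\<lambda>x. cmod (c * f x) powr p) = (\<lambda>x. cmod c powr p * cmod (f x) powr p)"
    by (simp add: norm_mult powr_mult)
  show "(\<lambda>x. c * f x) \<in> Lp_carrier (ennreal p)"
    using assms by (simp add: Lp_carrier_real_iff *)
  show "Lp_norm (ennreal p) (\<lambda>x. c * f x) = cmod c * Lp_norm (ennreal p) f"
    using p1 assms by (simp add: Lp_norm_real * powr_mult powr_powr)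
qed

text \<open>For a and b strictly above the two norms, f + g is a + b times the convex combination of
  f / a and g / b with weights a / (a + b) and b / (a + b). Convexity of t^p then bounds the
  integral by (a + b)^p. Strictness keeps the divisions legitimate when a norm is 0.\<close>

lemma Lp_triangle:
  assumes f: "f \<in> Lp_carrier (ennreal p)" and g: "g \<in> Lp_carrier (ennreal p)"
  shows "(\<lambda>x. f x + g x) \<in> Lp_carrier (ennreal p)"
    "Lp_norm (ennreal p) (\<lambda>x. f x + g x) \<le> Lp_norm (ennreal p) f + Lp_norm (ennreal p) g"
proof -
  have [measurable]: "f \<in> borel_measurable borel" "g \<in> borel_measurable borel"
    using f g by (auto simp: Lp_carrier_real_iff)
  let ?N = "Lp_norm (ennreal p) :: _ \<Rightarrow> real"
  have *: "(\<integral>\<^sup>+x. ennreal (cmod (f x + g x) powr p) \<partial>lborel) \<le> ennreal ((a + b) powr p)"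
    if a: "?N f < a" and b: "?N g < b" for a b
  proof -
    have pos: "0 < a" "0 < b" using a b Lp_norm_nonneg le_less_trans by blast+
    define s t where "s = a / (a + b)" and "t = b / (a + b)"
    have st: "0 \<le> s" "0 \<le> t" "s + t = 1"
      using pos by (auto simp: s_def t_def simp flip: add_divide_distrib)
    have ineq: "cmod (f x + g x) powr p \<le>
      (a + b) powr p * s / a powr p * cmod (f x) powr p + (a + b) powr p * t / b powr p * cmod (g x) powr p" for x
    proof -
      have "cmod (f x + g x) powr p \<le> (cmod (f x) + cmod (g x)) powr p"
        using p1 by (intro powr_mono2 norm_triangle_ineq) auto
      also have "cmod (f x) + cmod (g x) = (a + b) * (s * (cmod (f x) / a) + t * (cmod (g x) / b))"
        using pos by (simp add: s_def t_def distrib_left)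
      also have "\<dots> powr p = (a + b) powr p * (s * (cmod (f x) / a) + t * (cmod (g x) / b)) powr p"
        using pos st by (intro powr_mult)
      also have "\<dots> \<le> (a + b) powr p * (s * (cmod (f x) / a) powr p + t * (cmod (g x) / b) powr p)"
        using pos st p1 by (intro mult_left_mono powr_convex_combination) auto
      also have "\<dots> = (a + b) powr p * s / a powr p * cmod (f x) powr p + (a + b) powr p * t / b powr p * cmod (g x) powr p"
        using pos by (simp add: powr_divide field_simps)
      finally show ?thesis .
    qed
    have "(\<integral>\<^sup>+x. ennreal (cmod (f x + g x) powr p) \<partial>lborel) \<le>
      (\<integral>\<^sup>+x. ennreal ((a + b) powr p * s / a powr p) * ennreal (cmod (f x) powr p)
         + ennreal ((a + b) powr p * t / b powr p) * ennreal (cmod (g x) powr p) \<partial>lborel)"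
      using ineq st pos
      by (intro nn_integral_mono) (simp flip: ennreal_mult ennreal_plus)
    also have "\<dots> = ennreal ((a + b) powr p * s / a powr p) * ennreal (?N f powr p)
         + ennreal ((a + b) powr p * t / b powr p) * ennreal (?N g powr p)"
      by (simp add: nn_integral_add nn_integral_cmult Lp_nn_integral f g)
    also have "\<dots> \<le> ennreal ((a + b) powr p * s / a powr p) * ennreal (a powr p)
         + ennreal ((a + b) powr p * t / b powr p) * ennreal (b powr p)"
      using a b p1 by (intro add_mono mult_left_mono ennreal_leI powr_mono2) auto
    also have "\<dots> = ennreal ((a + b) powr p * s + (a + b) powr p * t)"
      using st pos by (simp flip: ennreal_mult ennreal_plus)
    also have "(a + b) powr p * s + (a + b) powr p * t = (a + b) powr p * (s + t)"
      by (simp add: distrib_left)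
    finally show ?thesis using st by simp
  qed
  show "(\<lambda>x. f x + g x) \<in> Lp_carrier (ennreal p)"
    by (rule Lp_leI(1)[OF _ _ *[of "?N f + 1" "?N g + 1"]]) (auto intro!: add_nonneg_nonneg)
  show "?N (\<lambda>x. f x + g x) \<le> ?N f + ?N g"
  proof (rule field_le_epsilon)
    fix e :: real assume "0 < e"
    then have "?N (\<lambda>x. f x + g x) \<le> (?N f + e / 2) + (?N g + e / 2)"
      by (intro Lp_leI(2) *) (auto intro!: add_nonneg_nonneg)
    then show "?N (\<lambda>x. f x + g x) \<le> ?N f + ?N g + e" by simp
  qed
qed

lemma Lp_diff:
  assumes f: "f \<in> Lp_carrier (ennreal p)" and g: "g \<in> Lp_carrier (ennreal p)"
  shows "(\<lambda>x. f x - g x) \<in> Lp_carrier (ennreal p)"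
    "Lp_norm (ennreal p) (\<lambda>x. f x - g x) \<le> Lp_norm (ennreal p) f + Lp_norm (ennreal p) g"
  using Lp_triangle[OF f Lp_scale(1)[OF g, of "-1"]] Lp_scale(2)[OF g, of "-1"] by auto

lemma Lp_sum:
  assumes "finite I" "\<And>i. i \<in> I \<Longrightarrow> g i \<in> Lp_carrier (ennreal p)"
  shows "(\<lambda>x. \<Sum>i\<in>I. g i x) \<in> Lp_carrier (ennreal p) \<and>
    Lp_norm (ennreal p) (\<lambda>x. \<Sum>i\<in>I. g i x) \<le> (\<Sum>i\<in>I. Lp_norm (ennreal p) (g i))"
  using assms
proof (induction I rule: finite_induct)
  case empty
  then show ?case by (simp add: Lp_zero Lp_norm_AE_0)
next
  case (insert i I)
  then show ?case
    using Lp_triangle[of "g i" "\<lambda>x. \<Sum>i\<in>I. g i x"] by auto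
qed

text \<open>The Riesz-Fischer argument: Minkowski bounds the norms of the partial sums
  \<open>A k\<close> of the moduli by S, and monotone convergence passes this to their supremum,
  which is therefore finite almost everywhere.\<close>

lemma Lp_series:
  assumes g: "\<And>i. g i \<in> Lp_carrier (ennreal p)"
    and sum: "summable (\<lambda>i. Lp_norm (ennreal p) (g i))"
  shows "AE x in lborel. summable (\<lambda>i. cmod (g i x))"
    "(\<lambda>x. \<Sum>i. g i x) \<in> Lp_carrier (ennreal p)"
    "Lp_norm (ennreal p) (\<lambda>x. \<Sum>i. g i x) \<le> (\<Sum>i. Lp_norm (ennreal p) (g i))"
proof -
  have [measurable]: "\<And>i. g i \<in> borel_measurable borel"
    using g by (auto simp: Lp_carrier_real_iff)
  let ?N = "Lp_norm (ennreal p) :: _ \<Rightarrow> real"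
  define S where "S = (\<Sum>i. ?N (g i))"
  define A where "A k x = (\<Sum>i<k. cmod (g i x))" for k x
  have [measurable]: "A k \<in> borel_measurable borel" for k
    unfolding A_def by measurable
  have A0: "0 \<le> A k x" for k x by (simp add: A_def sum_nonneg)
  have Amono: "A k x \<le> A l x" if "k \<le> l" for k l x
    unfolding A_def using that by (intro sum_mono2) auto
  have S0: "0 \<le> S" unfolding S_def by (intro suminf_nonneg sum) auto
  \<comment> \<open>The moduli are regarded as complex functions, the only ones
    \<open>Lp_carrier\<close> contains, so that Minkowski applies to them.\<close>
  have cg: "(\<lambda>x. complex_of_real (cmod (g i x))) \<in> Lp_carrier (ennreal p)"
    "?N (\<lambda>x. complex_of_real (cmod (g i x))) \<le> ?N (g i)" for i
    using Lp_dominated[OF _ g[of i], of "\<lambda>x. complex_of_real (cmod (g i x))"] by auto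
  have bound: "(\<integral>\<^sup>+x. ennreal (A k x powr p) \<partial>lborel) \<le> ennreal (S powr p)" for k
  proof -
    let ?h = "\<lambda>x. \<Sum>i<k. complex_of_real (cmod (g i x))"
    have h: "?h \<in> Lp_carrier (ennreal p)" "?N ?h \<le> (\<Sum>i<k. ?N (\<lambda>x. complex_of_real (cmod (g i x))))"
      using Lp_sum[of "{..<k}" "\<lambda>i x. complex_of_real (cmod (g i x))"] cg by auto
    note h(2)
    also have "\<dots> \<le> (\<Sum>i<k. ?N (g i))" by (intro sum_mono cg)
    also have "\<dots> \<le> S" unfolding S_def by (rule sum_le_suminf[OF sum]) auto
    finally have "?N ?h \<le> S" .
    moreover have "cmod (?h x) = A k x" for x
      using A0[of k x] by (simp add: A_def flip: of_real_sum)
    ultimately show ?thesis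
      using Lp_nn_integral[OF h(1)] p1 by (auto intro!: ennreal_leI powr_mono2)
  qed
  have inc: "incseq (\<lambda>k x. ennreal (A k x powr p))"
    using p1 A0 Amono by (auto simp: incseq_def le_fun_def intro!: ennreal_leI powr_mono2)
  have sup: "(\<integral>\<^sup>+x. (SUP k. ennreal (A k x powr p)) \<partial>lborel) \<le> ennreal (S powr p)"
    by (subst nn_integral_monotone_convergence_SUP[OF inc]) (auto intro!: SUP_least bound)
  then have "(\<integral>\<^sup>+x. (SUP k. ennreal (A k x powr p)) \<partial>lborel) \<noteq> \<infinity>"
    by (auto simp: top_unique)
  then have "AE x in lborel. (SUP k. ennreal (A k x powr p)) \<noteq> \<infinity>"
    by (intro nn_integral_PInf_AE) auto
  then show AE: "AE x in lborel. summable (\<lambda>i. cmod (g i x))"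
  proof eventually_elim
    case (elim x)
    then obtain c where c: "0 \<le> c" "(SUP k. ennreal (A k x powr p)) = ennreal c"
      by (cases "SUP k. ennreal (A k x powr p)") auto
    have "A k x \<le> c powr (1 / p)" for k
    proof -
      have "ennreal (A k x powr p) \<le> ennreal c" unfolding c(2)[symmetric] by (rule SUP_upper) simp
      then have "A k x powr p \<le> c" using c by simp
      then have "(A k x powr p) powr (1 / p) \<le> c powr (1 / p)" using p1 by (intro powr_mono2) auto
      then show ?thesis using p1 A0 by (simp add: powr_powr)
    qed
    then show ?case unfolding A_def by (intro summableI_nonneg_bounded) auto
  qed
  have "(\<integral>\<^sup>+x. ennreal (cmod (\<Sum>i. g i x) powr p) \<partial>lborel) \<le> (\<integral>\<^sup>+x. (SUP k. ennreal (A k x powr p)) \<partial>lborel)"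
  proof (rule nn_integral_mono_AE, use AE in eventually_elim)
    case (elim x)
    have "(\<lambda>k. A k x) \<longlonglongrightarrow> (\<Sum>i. cmod (g i x))"
      unfolding A_def by (rule summable_LIMSEQ[OF elim])
    then have "(\<lambda>k. ennreal (A k x powr p)) \<longlonglongrightarrow> ennreal ((\<Sum>i. cmod (g i x)) powr p)"
      using p1 A0 by (intro tendsto_ennrealI tendsto_powr') (auto intro!: always_eventually)
    then have "ennreal ((\<Sum>i. cmod (g i x)) powr p) \<le> (SUP k. ennreal (A k x powr p))"
      by (rule LIMSEQ_le_const2) (auto intro!: exI[of _ 0] SUP_upper)
    moreover have "cmod (\<Sum>i. g i x) powr p \<le> (\<Sum>i. cmod (g i x)) powr p"
      using p1 elim by (intro powr_mono2 summable_norm) auto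
    ultimately show ?case by (meson ennreal_leI order_trans)
  qed
  also note sup
  finally show "(\<lambda>x. \<Sum>i. g i x) \<in> Lp_carrier (ennreal p)" "?N (\<lambda>x. \<Sum>i. g i x) \<le> (\<Sum>i. ?N (g i))"
    using S0 unfolding S_def[symmetric] by (auto intro!: Lp_leI)
qed

text \<open>Almost everywhere the remainder is the sum of the shifted series, so its norm is at most
  the tail of the series of norms.\<close>

lemma Lp_series_tendsto:
  assumes g: "\<And>i. g i \<in> Lp_carrier (ennreal p)"
    and sum: "summable (\<lambda>i. Lp_norm (ennreal p) (g i))"
  shows "(\<lambda>k. Lp_norm (ennreal p) (\<lambda>x. (\<Sum>i. g i x) - (\<Sum>i<k. g i x))) \<longlonglongrightarrow> 0"
proof (rule tendsto_sandwich[OF _ _ tendsto_const])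
  let ?N = "Lp_norm (ennreal p) :: _ \<Rightarrow> real"
  have [measurable]: "\<And>i. g i \<in> borel_measurable borel"
    using g by (auto simp: Lp_carrier_real_iff)
  have "?N (\<lambda>x. (\<Sum>i. g i x) - (\<Sum>i<k. g i x)) \<le> (\<Sum>i. ?N (g (i + k)))" for k
  proof -
    have sumk: "summable (\<lambda>i. ?N (g (i + k)))"
      using sum by (subst summable_iff_shift[of "\<lambda>i. ?N (g i)"])
    have "AE x in lborel. cmod ((\<Sum>i. g i x) - (\<Sum>i<k. g i x)) \<le> cmod (\<Sum>i. g (i + k) x)"
      using Lp_series(1)[OF g sum]
    proof eventually_elim
      case (elim x)
      have "(\<Sum>i. g i x) = (\<Sum>i. g (i + k) x) + (\<Sum>i<k. g i x)"
        by (rule suminf_split_initial_segment) (rule summable_norm_cancel[OF elim])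
      then show ?case by simp
    qed
    then have "?N (\<lambda>x. (\<Sum>i. g i x) - (\<Sum>i<k. g i x)) \<le> ?N (\<lambda>x. \<Sum>i. g (i + k) x)"
      by (intro Lp_dominated(2) Lp_series(2)[of "\<lambda>i. g (i + k)"] g sumk) measurable
    also have "\<dots> \<le> (\<Sum>i. ?N (g (i + k)))"
      by (intro Lp_series(3) g sumk)
    finally show ?thesis .
  qed
  then show "\<forall>\<^sub>F k in sequentially. ?N (\<lambda>x. (\<Sum>i. g i x) - (\<Sum>i<k. g i x)) \<le> (\<Sum>i. ?N (g (i + k)))"
    by simp
  show "(\<lambda>k. \<Sum>i. ?N (g (i + k))) \<longlonglongrightarrow> 0"
    by (rule suminf_exist_split2[OF sum])
qed (auto intro!: always_eventually)

section \<open>Norms of functionals\<close>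

lemma dual_bound:
  fixes l :: "('a::euclidean_space \<Rightarrow> complex) \<Rightarrow> complex"
  assumes l: "l \<in> dual_space (Lp (ennreal p))" and f: "f \<in> Lp_carrier (ennreal p)"
  shows "cmod (l f) \<le> dual_norm (Lp (ennreal p)) l * Lp_norm (ennreal p) f"
proof -
  let ?N = "Lp_norm (ennreal p) :: ('a \<Rightarrow> complex) \<Rightarrow> real"
  obtain C where C: "\<And>f. f \<in> Lp_carrier (ennreal p) \<Longrightarrow> cmod (l f) \<le> C * ?N f"
    using l unfolding dual_space_def Lp_sel by blast
  have C': "cmod (l f) \<le> \<bar>C\<bar> * ?N f" if "f \<in> Lp_carrier (ennreal p)" for f :: "'a \<Rightarrow> complex"
    using C[OF that] by (rule order_trans) (auto intro!: mult_right_mono)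
  \<comment> \<open>A real \<open>SUP\<close> is an upper bound only over a bounded set, so the
    constant C from \<open>dual_space\<close> has to be brought in first. Its absolute value is
    taken because C may be negative.\<close>
  have bdd: "bdd_above ((\<lambda>f. cmod (l f)) ` {f \<in> Lp_carrier (ennreal p). ?N f \<le> 1})"
  proof (intro bdd_aboveI2)
    fix f :: "'a \<Rightarrow> complex" assume "f \<in> {f \<in> Lp_carrier (ennreal p). ?N f \<le> 1}"
    then show "cmod (l f) \<le> \<bar>C\<bar>"
      using C'[of f] mult_left_mono[of "?N f" 1 "\<bar>C\<bar>"] by auto
  qed
  show ?thesis
  proof (cases "?N f = 0")
    case True
    then show ?thesis using C[OF f] by simp
  next
    case False
    then have pos: "0 < ?N f" by (simp add: less_le)
    let ?g = "\<lambda>x. complex_of_real (1 / ?N f) * f x"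
    have g: "?g \<in> Lp_carrier (ennreal p)" "?N ?g = 1"
      using Lp_scale[OF f, of "complex_of_real (1 / ?N f)"] pos by (auto simp: norm_divide)
    have "cmod (l ?g) \<le> dual_norm (Lp (ennreal p)) l"
      unfolding dual_norm_def Lp_sel by (rule cSUP_upper[OF _ bdd]) (use g in auto)
    moreover have "l ?g = complex_of_real (1 / ?N f) * l f"
      using l f unfolding dual_space_def Lp_sel by blast
    then have "cmod (l ?g) = cmod (l f) / ?N f"
      by (simp only: norm_mult) (simp add: norm_divide)
    ultimately have "cmod (l f) / ?N f \<le> dual_norm (Lp (ennreal p)) l" by (simp only:)
    then show ?thesis using pos by (simp add: field_simps)
  qed
qed

lemma dual_norm_nonneg:
  assumes "l \<in> dual_space (Lp (ennreal p))"
  shows "0 \<le> dual_norm (Lp (ennreal p)) (l :: ('a::euclidean_space \<Rightarrow> _) \<Rightarrow> _)"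
proof -
  obtain C where C: "\<And>f. f \<in> Lp_carrier (ennreal p) \<Longrightarrow> cmod (l f) \<le> C * Lp_norm (ennreal p) f"
    using assms unfolding dual_space_def Lp_sel by blast
  have "bdd_above ((\<lambda>f. cmod (l f)) ` {f \<in> Lp_carrier (ennreal p). Lp_norm (ennreal p) f \<le> 1})"
  proof (intro bdd_aboveI2)
    fix f :: "'a \<Rightarrow> complex" assume "f \<in> {f \<in> Lp_carrier (ennreal p). Lp_norm (ennreal p) f \<le> 1}"
    then show "cmod (l f) \<le> \<bar>C\<bar>"
      using C[of f] mult_right_mono[OF abs_ge_self[of C], of "Lp_norm (ennreal p) f"]
        mult_left_mono[of "Lp_norm (ennreal p) f" 1 "\<bar>C\<bar>"] by auto
  qed
  then have "cmod (l (\<lambda>x. 0)) \<le> dual_norm (Lp (ennreal p)) l"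
    unfolding dual_norm_def Lp_sel
    by (rule cSUP_upper[rotated]) (auto simp: Lp_zero Lp_norm_AE_0)
  then show ?thesis by (meson norm_ge_zero order_trans)
qed

lemma dual_norm_le:
  assumes "\<And>f. f \<in> Lp_carrier (ennreal p) \<Longrightarrow> cmod (l f) \<le> C * Lp_norm (ennreal p) f" "0 \<le> C"
  shows "dual_norm (Lp (ennreal p)) (l :: ('a::euclidean_space \<Rightarrow> _) \<Rightarrow> _) \<le> C"
  unfolding dual_norm_def Lp_sel
proof (rule cSUP_least)
  show "{f \<in> Lp_carrier (ennreal p). Lp_norm (ennreal p) (f :: 'a \<Rightarrow> complex) \<le> 1} \<noteq> {}"
    using Lp_zero Lp_norm_AE_0[of "\<lambda>x::'a. 0"] by (auto intro!: exI[of _ "\<lambda>x. 0"])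
  fix f :: "'a \<Rightarrow> complex" assume "f \<in> {f \<in> Lp_carrier (ennreal p). Lp_norm (ennreal p) f \<le> 1}"
  then show "cmod (l f) \<le> C"
    using assms(1)[of f] mult_left_mono[of "Lp_norm (ennreal p) f" 1 C] assms(2) by auto
qed

end

section \<open>Hoelder's inequality, with the conjugate exponent possibly infinite\<close>

context
  fixes p :: real
  assumes p1: "1 \<le> p"
begin

lemma conjugate_exponent_real:
  assumes "1 / ennreal p + 1 / q = 1" "q \<noteq> \<infinity>"
  obtains q' where "q = ennreal q'" "1 < p" "1 < q'" "1 / p + 1 / q' = 1"
proof -
  obtain q' where q': "q = ennreal q'" "0 \<le> q'" using assms(2) by (cases q) auto
  \<comment> \<open>In \<open>ennreal\<close> the quotient 1 / 0 is infinite, so q' = 0 contradicts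
    the sum being 1.\<close>
  have "q' \<noteq> 0" using assms(1) q' by (auto simp: ennreal_divide_zero ennreal_add_eq_top)
  then have "0 < q'" using q' by simp
  then have "ennreal (1 / p + 1 / q') = ennreal 1"
    using assms(1) p1 divide_ennreal[of 1 p] divide_ennreal[of 1 q'] by (simp add: q')
  then have conj: "1 / p + 1 / q' = 1" using p1 \<open>0 < q'\<close> by (subst (asm) ennreal_inj) auto
  have "0 < 1 / q'" "0 < 1 / p" using p1 \<open>0 < q'\<close> by auto
  then have "1 / p < 1" "1 / q' < 1" using conj by linarith+
  then have "1 < p" "1 < q'" using p1 \<open>0 < q'\<close> by (auto simp: field_simps)
  with q' conj show ?thesis by (intro that)
qed

text \<open>An infinite q forces p = 1, and the essential supremum bounds g almost everywhere.
  Otherwise Young's inequality is applied to |f| / a and |g| / b with a and b strictly above the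
  norms; integrating gives a b (1/p + 1/q') = a b.\<close>

lemma Holder_nn_integral:
  assumes "1 / ennreal p + 1 / q = 1"
    and f: "f \<in> Lp_carrier (ennreal p)" and g: "g \<in> Lp_carrier q"
  shows "(\<integral>\<^sup>+x. ennreal (cmod (f x * g x)) \<partial>lborel) \<le> ennreal (Lp_norm (ennreal p) f * Lp_norm q g)"
proof (cases "q = \<infinity>")
  case True
  have m[measurable]: "f \<in> borel_measurable borel" "g \<in> borel_measurable borel"
    using f g by (auto simp: Lp_carrier_def)
  have "1 / ennreal p = 1" using assms(1) True by simp
  moreover have "1 / ennreal p = ennreal (1 / p)"
    using p1 divide_ennreal[of 1 p] by simp
  ultimately have "1 / p = 1" by simp
  then have "p = 1" using p1 by simp
  let ?M = "esssup lborel (\<lambda>x. ennreal (cmod (g x)))"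
  have M: "?M = ennreal (Lp_norm q g)"
    using g True by (auto simp: Lp_carrier_def Lp_norm_def)
  have "AE x in lborel. ennreal (cmod (g x)) \<le> ?M" by (rule esssup_AE)
  then have "(\<integral>\<^sup>+x. ennreal (cmod (f x * g x)) \<partial>lborel) \<le> (\<integral>\<^sup>+x. ennreal (cmod (f x) powr p) * ?M \<partial>lborel)"
    by (intro nn_integral_mono_AE)
      (auto elim!: eventually_mono intro!: mult_left_mono simp: norm_mult ennreal_mult \<open>p = 1\<close>)
  also have "\<dots> = ennreal (Lp_norm (ennreal p) f) * ?M"
    using Lp_nn_integral[OF p1 f] by (simp add: nn_integral_multc \<open>p = 1\<close>)
  finally show ?thesis by (simp add: M ennreal_mult)
next
  case False
  have m[measurable]: "f \<in> borel_measurable borel" "g \<in> borel_measurable borel"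
    using f g by (auto simp: Lp_carrier_def)
  obtain q' where q': "q = ennreal q'" and "1 < p" "1 < q'" and conj: "1 / p + 1 / q' = 1"
    using conjugate_exponent_real[OF assms(1) False] by blast
  let ?F = "Lp_norm (ennreal p) f" and ?G = "Lp_norm q g"
  have G: "(\<integral>\<^sup>+x. ennreal (cmod (g x) powr q') \<partial>lborel) = ennreal (?G powr q')"
    using g \<open>1 < q'\<close> by (simp add: q' Lp_nn_integral)
  have *: "(\<integral>\<^sup>+x. ennreal (cmod (f x * g x)) \<partial>lborel) \<le> ennreal (a * b)" if "?F < a" "?G < b" for a b
  proof -
    have pos: "0 < a" "0 < b" using that Lp_norm_nonneg le_less_trans by blast+
    have "cmod (f x * g x) \<le> (a * b / p / a powr p) * cmod (f x) powr p + (a * b / q' / b powr q') * cmod (g x) powr q'" for x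
    proof -
      have "cmod (f x) / a * (cmod (g x) / b) \<le> (cmod (f x) / a) powr p / p + (cmod (g x) / b) powr q' / q'"
        using \<open>1 < p\<close> \<open>1 < q'\<close> conj pos by (intro Youngs_inequality) auto
      then have "a * b * (cmod (f x) / a * (cmod (g x) / b)) \<le> a * b * ((cmod (f x) / a) powr p / p + (cmod (g x) / b) powr q' / q')"
        using pos by (intro mult_left_mono) auto
      then show ?thesis using pos by (simp add: norm_mult powr_divide field_simps)
    qed
    then have "(\<integral>\<^sup>+x. ennreal (cmod (f x * g x)) \<partial>lborel) \<le>
      (\<integral>\<^sup>+x. ennreal (a * b / p / a powr p) * ennreal (cmod (f x) powr p)
         + ennreal (a * b / q' / b powr q') * ennreal (cmod (g x) powr q') \<partial>lborel)"
      using pos \<open>1 < p\<close> \<open>1 < q'\<close>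
      by (intro nn_integral_mono) (simp flip: ennreal_mult ennreal_plus)
    also have "\<dots> = ennreal (a * b / p / a powr p) * ennreal (?F powr p)
         + ennreal (a * b / q' / b powr q') * ennreal (?G powr q')"
      by (simp add: nn_integral_add nn_integral_cmult Lp_nn_integral[OF p1 f] G)
    also have "\<dots> \<le> ennreal (a * b / p / a powr p) * ennreal (a powr p)
         + ennreal (a * b / q' / b powr q') * ennreal (b powr q')"
      using that \<open>1 < p\<close> \<open>1 < q'\<close> by (intro add_mono mult_left_mono ennreal_leI powr_mono2) auto
    also have "\<dots> = ennreal (a * b * (1 / p + 1 / q'))"
      using pos \<open>1 < p\<close> \<open>1 < q'\<close> by (simp add: algebra_simps flip: ennreal_mult ennreal_plus)
    finally show ?thesis using conj by simp
  qed
  have fin: "(\<integral>\<^sup>+x. ennreal (cmod (f x * g x)) \<partial>lborel) < \<infinity>"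
    using *[of "?F + 1" "?G + 1"] by (auto intro: le_less_trans)
  then obtain X where X: "(\<integral>\<^sup>+x. ennreal (cmod (f x * g x)) \<partial>lborel) = ennreal X" "0 \<le> X"
    by (cases "\<integral>\<^sup>+x. ennreal (cmod (f x * g x)) \<partial>lborel") auto
  \<comment> \<open>The majorants a and b, strict so that a vanishing norm never stands in a
    denominator, now descend to the norms.\<close>
  have "X \<le> ?F * ?G"
  proof (rule le_mult_limit)
    fix a b assume ab: "?F < a" "?G < b"
    then have "0 < a" "0 < b" using Lp_norm_nonneg le_less_trans by blast+
    then show "X \<le> a * b" using *[OF ab] X by simp
  qed
  then show ?thesis using X by (simp add: ennreal_leI)
qed

lemma Holder:
  assumes "1 / ennreal p + 1 / q = 1"
    and f: "f \<in> Lp_carrier (ennreal p)" and g: "g \<in> Lp_carrier q"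
  shows "integrable lborel (\<lambda>x. f x * g x)"
    "(LINT x|lborel. cmod (f x * g x)) \<le> Lp_norm (ennreal p) f * Lp_norm q g"
    "cmod (LINT x|lborel. f x * g x) \<le> Lp_norm (ennreal p) f * Lp_norm q g"
proof -
  have [measurable]: "f \<in> borel_measurable borel" "g \<in> borel_measurable borel"
    using f g by (auto simp: Lp_carrier_def)
  note H = Holder_nn_integral[OF assms]
  show int: "integrable lborel (\<lambda>x. f x * g x)"
    using H by (auto simp: integrable_iff_bounded intro: le_less_trans)
  show le: "(LINT x|lborel. cmod (f x * g x)) \<le> Lp_norm (ennreal p) f * Lp_norm q g"
    using H int by (subst (asm) nn_integral_eq_integral) (auto simp: ennreal_le_iff)
  show "cmod (LINT x|lborel. f x * g x) \<le> Lp_norm (ennreal p) f * Lp_norm q g"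
    using integral_norm_bound le by (rule order_trans)
qed

end

section \<open>Uniqueness of the nuclear trace\<close>

text \<open>The inclusion of l^r in l^1: the terms a_i^r tend to 0, so eventually a_i \<le> 1, and
  there a_i \<le> a_i^r because r \<le> 1.\<close>

lemma summable_of_summable_powr:
  fixes a :: "nat \<Rightarrow> real"
  assumes "0 < r" "r \<le> 1" "\<And>i. 0 \<le> a i" "summable (\<lambda>i. a i powr r)"
  shows "summable a"
proof (rule summable_comparison_test_ev[OF _ assms(4)])
  have "eventually (\<lambda>i. a i powr r < 1) sequentially"
    using summable_LIMSEQ_zero[OF assms(4)] by (rule order_tendstoD) simp
  then show "\<forall>\<^sub>F i in sequentially. norm (a i) \<le> a i powr r"
  proof eventually_elim
    case (elim i)
    have "a i \<le> 1"
    proof (rule ccontr)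
      assume "\<not> a i \<le> 1"
      then have "1 < a i powr r" using assms(1) by (intro gr_one_powr) auto
      then show False using elim by simp
    qed
    then have "a i powr 1 \<le> a i powr r"
      using assms by (intro powr_mono') auto
    then show ?case using assms(3)[of i] by simp
  qed
qed

lemma dual_space_add: "l \<in> dual_space E \<Longrightarrow> f \<in> vecs E \<Longrightarrow> g \<in> vecs E \<Longrightarrow> l (\<lambda>x. f x + g x) = l f + l g"
  and dual_space_scale: "l \<in> dual_space E \<Longrightarrow> f \<in> vecs E \<Longrightarrow> l (\<lambda>x. c * f x) = c * l f"
  by (auto simp: dual_space_def)

context
  fixes p :: real
  assumes p1: "1 \<le> p"
begin

lemma dual_diff:
  assumes "l \<in> dual_space (Lp (ennreal p))" "f \<in> Lp_carrier (ennreal p)" "g \<in> Lp_carrier (ennreal p)"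
  shows "l (\<lambda>x. f x - g x) = l f - l g"
  using dual_space_add[OF assms(1), of f "\<lambda>x. -1 * g x"] dual_space_scale[OF assms(1), of g "-1"]
    assms Lp_scale(1)[OF p1 assms(3), of "-1"] by simp

lemma dual_sum:
  assumes "l \<in> dual_space (Lp (ennreal p))" "finite I" "\<And>i. i \<in> I \<Longrightarrow> f i \<in> Lp_carrier (ennreal p)"
  shows "l (\<lambda>x. \<Sum>i\<in>I. c i * f i x) = (\<Sum>i\<in>I. c i * l (f i))"
  using assms(2,3)
proof (induction I rule: finite_induct)
  case empty
  then show ?case using dual_space_scale[OF assms(1), of "\<lambda>x. 0" 0] by (simp add: Lp_zero p1)
next
  case (insert i I)
  then have "(\<lambda>x. \<Sum>i\<in>I. c i * f i x) \<in> Lp_carrier (ennreal p)"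
    using Lp_sum[OF p1, of I "\<lambda>i x. c i * f i x"] by (auto intro!: Lp_scale p1)
  moreover have "(\<lambda>x. c i * f i x) \<in> Lp_carrier (ennreal p)"
    using insert by (intro Lp_scale p1) auto
  ultimately show ?case using insert
    by (simp add: dual_space_add[OF assms(1)] dual_space_scale[OF assms(1)])
qed

section \<open>Contractions of finite rank from averages\<close>

lemma Lp_simple_approx:
  fixes g :: "'a::euclidean_space \<Rightarrow> complex"
  assumes g: "g \<in> Lp_carrier (ennreal p)" and "0 < \<epsilon>"
  obtains s where "s \<in> Lp_carrier (ennreal p)" "finite (range s)"
    "Lp_norm (ennreal p) (\<lambda>x. g x - s x) < \<epsilon>"
proof -
  have [measurable]: "g \<in> borel_measurable borel"
    and gi: "integrable lborel (\<lambda>x. cmod (g x) powr p)"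
    using g by (auto simp: Lp_carrier_real_iff p1)
  have gl: "g \<in> borel_measurable lborel" by simp
  obtain F where F: "\<And>i. simple_function lborel (F i)" "\<And>x. (\<lambda>i. F i x) \<longlonglongrightarrow> g x"
    "\<And>i x. cmod (F i x) \<le> 2 * cmod (g x)"
    using borel_measurable_implies_sequence_metric[OF gl, of 0] by auto
  have [measurable]: "F i \<in> borel_measurable borel" for i
    using borel_measurable_simple_function[OF F(1)[of i]] by simp
  have FL: "F i \<in> Lp_carrier (ennreal p)" for i
    by (rule Lp_dominated[OF p1 _ Lp_scale(1)[OF p1 g, of 2]]) (use F(3) in \<open>auto simp: norm_mult\<close>)
  have "(\<lambda>i. LINT x|lborel. cmod (g x - F i x) powr p) \<longlonglongrightarrow> (LINT x|(lborel :: 'a measure). 0::real)"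
  proof (rule integral_dominated_convergence)
    \<comment> \<open>The 3 comes from |g - F i| \<le> |g| + 2 |g|.\<close>
    show "integrable lborel (\<lambda>x. 3 powr p * cmod (g x) powr p)" using gi by simp
    show "AE x in lborel. norm (cmod (g x - F i x) powr p) \<le> 3 powr p * cmod (g x) powr p" for i
    proof (rule AE_I2)
      fix x
      have "cmod (g x - F i x) \<le> 3 * cmod (g x)"
        using norm_triangle_ineq4[of "g x" "F i x"] F(3)[of i x] by simp
      then have "cmod (g x - F i x) powr p \<le> (3 * cmod (g x)) powr p"
        using p1 by (intro powr_mono2) auto
      then show "norm (cmod (g x - F i x) powr p) \<le> 3 powr p * cmod (g x) powr p"
        by (simp add: powr_mult)
    qed
    show "AE x in lborel. (\<lambda>i. cmod (g x - F i x) powr p) \<longlonglongrightarrow> 0"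
    proof (rule AE_I2)
      fix x
      have "(\<lambda>i. cmod (g x - F i x)) \<longlonglongrightarrow> cmod (g x - g x)" by (intro tendsto_intros F(2))
      then have "(\<lambda>i. cmod (g x - F i x) powr p) \<longlonglongrightarrow> 0 powr p"
        using p1 by (intro tendsto_powr') auto
      then show "(\<lambda>i. cmod (g x - F i x) powr p) \<longlonglongrightarrow> 0" by simp
    qed
  qed auto
  then have "(\<lambda>i. (LINT x|lborel. cmod (g x - F i x) powr p) powr (1 / p)) \<longlonglongrightarrow> 0 powr (1 / p)"
    using p1 by (intro tendsto_powr') (auto intro!: always_eventually)
  then have "(\<lambda>i. Lp_norm (ennreal p) (\<lambda>x. g x - F i x)) \<longlonglongrightarrow> 0"
    by (simp add: Lp_norm_real p1)
  then have "eventually (\<lambda>i. Lp_norm (ennreal p) (\<lambda>x. g x - F i x) < \<epsilon>) sequentially"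
    using \<open>0 < \<epsilon>\<close> by (rule order_tendstoD)
  then obtain i where "Lp_norm (ennreal p) (\<lambda>x. g x - F i x) < \<epsilon>"
    by (auto simp: eventually_sequentially)
  moreover have "finite (range (F i))" using F(1)[of i] by (auto simp: simple_function_def)
  ultimately show ?thesis using FL that by blast
qed

text \<open>The bound |g| \<le> 1 + |g|^p makes g integrable on sets of finite measure, so that its
  average over such a set is a genuine integral.\<close>

lemma Lp_integrable_indicator:
  assumes g: "g \<in> Lp_carrier (ennreal p)" and Q: "Q \<in> sets borel" "emeasure lborel Q < \<infinity>"
  shows "integrable lborel (\<lambda>x. indicator Q x * g x)"
proof (rule Bochner_Integration.integrable_bound)
  have [measurable]: "g \<in> borel_measurable borel"
    and gi: "integrable lborel (\<lambda>x. cmod (g x) powr p)"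
    using g by (auto simp: Lp_carrier_real_iff p1)
  show "integrable lborel (\<lambda>x. indicator Q x + cmod (g x) powr p)"
    using Q gi by (intro Bochner_Integration.integrable_add integrable_real_indicator) auto
  show "(\<lambda>x. indicator Q x * g x) \<in> borel_measurable lborel" using Q by measurable
  show "AE x in lborel. cmod (indicator Q x * g x) \<le> norm (indicator Q x + cmod (g x) powr p)"
  proof (rule AE_I2)
    fix x
    have "cmod (g x) \<le> 1 + cmod (g x) powr p"
    proof (cases "cmod (g x) \<le> 1")
      case False
      then have "cmod (g x) powr 1 \<le> cmod (g x) powr p" using p1 by (intro powr_mono) auto
      then show ?thesis using False by simp
    qed (simp add: add_increasing2)
    then show "cmod (indicator Q x * g x) \<le> norm (indicator Q x + cmod (g x) powr p)"
      by (auto simp: indicator_def)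
  qed
qed

text \<open>Jensen's inequality. The tangent inequality at c, the modulus of the average, is
  integrated over Q; its linear part contributes a nonnegative amount, because c times the measure
  of Q is at most the integral of |g| over Q.\<close>

lemma average_powr_le:
  assumes g: "g \<in> Lp_carrier (ennreal p)" and Q: "Q \<in> sets borel" "emeasure lborel Q < \<infinity>"
  shows "cmod ((LINT x|lborel. indicator Q x * g x) / measure lborel Q) powr p * measure lborel Q
    \<le> (LINT x|lborel. indicator Q x * cmod (g x) powr p)"
proof (cases "measure lborel Q = 0")
  case True
  then show ?thesis by simp
next
  case False
  then have pos: "0 < measure lborel Q" by (simp add: less_le)
  define c where "c = cmod (LINT x|lborel. indicator Q x * g x) / measure lborel Q"
  have c0: "0 \<le> c" by (simp add: c_def)
  have [measurable]: "g \<in> borel_measurable borel"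
    and gi: "integrable lborel (\<lambda>x. cmod (g x) powr p)"
    using g by (auto simp: Lp_carrier_real_iff p1)
  have int: "integrable lborel (\<lambda>x. indicator Q x * cmod (g x))"
    using integrable_norm[OF Lp_integrable_indicator[OF g Q]]
    by (rule Bochner_Integration.integrable_cong[THEN iffD1, rotated -1])
      (auto simp: norm_mult indicator_def)
  have intQ: "integrable lborel (indicator Q :: _ \<Rightarrow> real)"
    using Q by (intro integrable_real_indicator) auto
  have intp: "integrable lborel (\<lambda>x. indicator Q x * cmod (g x) powr p)"
    using integrable_real_mult_indicator[OF _ gi, of Q] Q by (simp add: mult.commute)
  have "c * measure lborel Q = cmod (LINT x|lborel. indicator Q x * g x)"
    using pos by (simp add: c_def)
  also have "\<dots> \<le> (LINT x|lborel. cmod (indicator Q x * g x))" by (rule integral_norm_bound)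
  also have "\<dots> = (LINT x|lborel. indicator Q x * cmod (g x))"
    by (intro Bochner_Integration.integral_cong) (auto simp: norm_mult indicator_def)
  finally have le: "c * measure lborel Q \<le> (LINT x|lborel. indicator Q x * cmod (g x))" .
  have "c powr p * measure lborel Q \<le> c powr p * measure lborel Q +
     p * c powr (p - 1) * ((LINT x|lborel. indicator Q x * cmod (g x)) - c * measure lborel Q)"
    using le p1 by simp
  also have "\<dots> = (LINT x|lborel. (c powr p - p * c powr (p - 1) * c) * indicator Q x +
     p * c powr (p - 1) * (indicator Q x * cmod (g x)))"
  proof -
    have "(LINT x|lborel. (c powr p - p * c powr (p - 1) * c) * indicator Q x +
       p * c powr (p - 1) * (indicator Q x * cmod (g x))) =
       (c powr p - p * c powr (p - 1) * c) * measure lborel Q +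
       p * c powr (p - 1) * (LINT x|lborel. indicator Q x * cmod (g x))"
      using int intQ Q by simp
    then show ?thesis by (simp add: algebra_simps)
  qed
  also have "\<dots> \<le> (LINT x|lborel. indicator Q x * cmod (g x) powr p)"
  proof (rule integral_mono)
    fix x
    show "(c powr p - p * c powr (p - 1) * c) * indicator Q x + p * c powr (p - 1) * (indicator Q x * cmod (g x))
      \<le> indicator Q x * cmod (g x) powr p"
      using powr_tangent[OF p1 _ c0, of "cmod (g x)"] by (auto simp: indicator_def algebra_simps)
  qed (use int intQ intp in auto)
  finally show ?thesis by (simp add: c_def norm_divide)
qed

lemma average_in_dual:
  assumes Q: "Q \<in> sets borel" "emeasure lborel Q < \<infinity>"
  shows "(\<lambda>g. (LINT x|lborel. indicator Q x * g x) / measure lborel Q) \<in> dual_space (Lp (ennreal p))"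
proof -
  let ?\<mu> = "measure lborel Q"
  \<comment> \<open>The constant results from dividing Jensen's inequality by the measure of Q and
    taking p-th roots. On a null set both sides make sense because \<open>x / 0 = 0\<close>, and the
    average is then 0.\<close>
  have "cmod ((LINT x|lborel. indicator Q x * g x) / ?\<mu>) \<le> (1 / ?\<mu>) powr (1 / p) * Lp_norm (ennreal p) g"
    if g: "g \<in> Lp_carrier (ennreal p)" for g
  proof (cases "?\<mu> = 0")
    case False
    then have pos: "0 < ?\<mu>" by (simp add: less_le)
    have [measurable]: "g \<in> borel_measurable borel"
      and gi: "integrable lborel (\<lambda>x. cmod (g x) powr p)"
      using g by (auto simp: Lp_carrier_real_iff p1)
    let ?a = "cmod ((LINT x|lborel. indicator Q x * g x) / ?\<mu>)"
    have "?a powr p * ?\<mu> \<le> (LINT x|lborel. indicator Q x * cmod (g x) powr p)"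
      by (rule average_powr_le[OF g Q])
    also have "\<dots> \<le> (LINT x|lborel. cmod (g x) powr p)"
      using gi integrable_real_mult_indicator[OF _ gi, of Q] Q
      by (intro integral_mono) (auto simp: indicator_def mult.commute)
    also have "\<dots> = Lp_norm (ennreal p) g powr p"
      by (simp add: Lp_norm_powr p1)
    finally have "?a powr p \<le> 1 / ?\<mu> * Lp_norm (ennreal p) g powr p"
      using pos by (simp add: field_simps)
    then have "(?a powr p) powr (1 / p) \<le> (1 / ?\<mu> * Lp_norm (ennreal p) g powr p) powr (1 / p)"
      using p1 by (intro powr_mono2) auto
    also have "\<dots> = (1 / ?\<mu>) powr (1 / p) * (Lp_norm (ennreal p) g powr p) powr (1 / p)"
      using pos by (intro powr_mult)
    finally show ?thesis using p1 by (simp add: powr_powr)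
  qed simp
  then show ?thesis
    unfolding dual_space_def Lp_sel using Lp_integrable_indicator[OF _ Q]
    by (auto simp: distrib_left add_divide_distrib mult.left_commute intro!: exI[of _ "(1 / ?\<mu>) powr (1 / p)"])
qed

text \<open>The functions in \<open>Y\<close> are replaced by simple functions;
  the averages over the common level sets of these then form the operator.\<close>

lemma finite_rank_approximation:
  fixes Y :: "('a::euclidean_space \<Rightarrow> complex) set"
  assumes Y: "finite Y" "Y \<subseteq> Lp_carrier (ennreal p)" and "0 < \<epsilon>"
  obtains J :: "(('a \<Rightarrow> complex) \<Rightarrow> complex) set" and l u where
    "finite J" "\<And>j. j \<in> J \<Longrightarrow> l j \<in> dual_space (Lp (ennreal p))"
    "\<And>j. j \<in> J \<Longrightarrow> u j \<in> Lp_carrier (ennreal p)"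
    "\<And>g. g \<in> Lp_carrier (ennreal p) \<Longrightarrow> Lp_norm (ennreal p) (\<lambda>x. \<Sum>j\<in>J. l j g * u j x) \<le> Lp_norm (ennreal p) g"
    "\<And>g. g \<in> Y \<Longrightarrow> Lp_norm (ennreal p) (\<lambda>x. g x - (\<Sum>j\<in>J. l j g * u j x)) \<le> \<epsilon>"
proof -
  let ?N = "Lp_norm (ennreal p) :: ('a \<Rightarrow> complex) \<Rightarrow> real"
  have "\<forall>g\<in>Y. \<exists>s. s \<in> Lp_carrier (ennreal p) \<and> finite (range s) \<and> ?N (\<lambda>x. g x - s x) < \<epsilon> / 2"
    using Lp_simple_approx[of _ "\<epsilon> / 2"] Y \<open>0 < \<epsilon>\<close> by (metis half_gt_zero subsetD)
  then obtain s where s: "\<And>g. g \<in> Y \<Longrightarrow> s g \<in> Lp_carrier (ennreal p)"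
    "\<And>g. g \<in> Y \<Longrightarrow> finite (range (s g))" "\<And>g. g \<in> Y \<Longrightarrow> ?N (\<lambda>x. g x - s g x) < \<epsilon> / 2"
    by metis
  \<comment> \<open>\<open>\<Phi> x\<close> records the values at x of all the simple functions; its
    fibres \<open>Q j\<close> are the atoms of their common partition. An atom is thus indexed by
    the tuple of values taken on it, which explains the type of J.\<close>
  define \<Phi> where "\<Phi> x = restrict (\<lambda>g. s g x) Y" for x
  \<comment> \<open>The atom where all the simple functions vanish is left out: it may have infinite
    measure. Every other atom has finite measure, since some p-integrable function is a nonzero
    constant on it.\<close>
  define J where "J = \<Phi> ` {x. \<exists>g\<in>Y. s g x \<noteq> 0}"
  define Q where "Q j = {x. \<Phi> x = j}" for j
  define l where "l j g = (LINT x|lborel. indicator (Q j) x * g x) / measure lborel (Q j)"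
    for j and g :: "'a \<Rightarrow> complex"
  define u where "u j x = (indicator (Q j) x :: complex)" for j x
  have finJ: "finite J"
  proof (rule finite_subset)
    show "J \<subseteq> PiE Y (\<lambda>g. range (s g))" by (auto simp: J_def \<Phi>_def)
    show "finite (PiE Y (\<lambda>g. range (s g)))" by (intro finite_PiE Y s)
  qed
  have sm: "s g \<in> borel_measurable borel" if "g \<in> Y" for g
    using s(1)[OF that] by (rule Lp_carrier_measurable)
  have Qeq: "Q j = {x. \<forall>g\<in>Y. s g x = j g}" if j: "j \<in> J" for j
  proof -
    obtain x0 where "j = \<Phi> x0" using j by (auto simp: J_def)
    then show ?thesis by (auto simp: Q_def \<Phi>_def fun_eq_iff)
  qed
  have Qm: "Q j \<in> sets borel" if "j \<in> J" for j
  proof -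
    have "{x \<in> space borel. \<forall>g\<in>Y. s g x = j g} \<in> sets borel"
      using sm Y(1) by (intro sets.sets_Collect_finite_All) auto
    then show ?thesis using Qeq[OF that] by simp
  qed
  have Qfin: "emeasure lborel (Q j) < \<infinity>" if j: "j \<in> J" for j
  proof -
    obtain g where g: "g \<in> Y" "j g \<noteq> 0" using j by (auto simp: J_def \<Phi>_def)
    have "integrable lborel (\<lambda>x. 1 / cmod (j g) powr p * cmod (s g x) powr p)"
      using s(1)[OF g(1)] by (simp add: Lp_carrier_real_iff p1)
    then have "integrable lborel (indicator (Q j) :: 'a \<Rightarrow> real)"
      by (rule Bochner_Integration.integrable_bound)
        (use g Qm[OF j] in \<open>auto simp: Qeq[OF j] indicator_def\<close>)
    then show ?thesis using Qm[OF j] by (simp add: integrable_indicator_iff)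
  qed
  have lD: "l j \<in> dual_space (Lp (ennreal p))" if "j \<in> J" for j
    unfolding l_def by (rule average_in_dual) (use Qm Qfin that in auto)
  have uL: "u j \<in> Lp_carrier (ennreal p)" if "j \<in> J" for j
  proof -
    have "integrable lborel (indicator (Q j) :: 'a \<Rightarrow> real)"
      using Qm[OF that] Qfin[OF that] by (intro integrable_real_indicator) auto
    moreover have "(\<lambda>x. cmod (u j x) powr p) = indicator (Q j)"
      using p1 by (auto simp: u_def indicator_def)
    ultimately show ?thesis using Qm[OF that] p1
      by (auto simp: Lp_carrier_real_iff u_def[abs_def])
  qed
  define P where "P g x = (\<Sum>j\<in>J. l j g * u j x)" for g x
  have Pval: "P g x = (if \<Phi> x \<in> J then l (\<Phi> x) g else 0)" for g x
  proof -
    have "P g x = (\<Sum>j\<in>J. if j = \<Phi> x then l j g else 0)"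
      unfolding P_def by (intro sum.cong) (auto simp: u_def Q_def)
    then show ?thesis using finJ by (simp add: sum.delta')
  qed
  have PL: "P g \<in> Lp_carrier (ennreal p)" for g
    using Lp_sum[OF p1 finJ, of "\<lambda>j x. l j g * u j x"] uL unfolding P_def[abs_def]
    by (auto intro!: Lp_scale p1)
  \<comment> \<open>\<open>P g\<close> is constant on each atom and 0 off them. Jensen bounds its
    p-th power atom by atom, and the atoms are disjoint.\<close>
  have contr: "?N (P g) \<le> ?N g" if g: "g \<in> Lp_carrier (ennreal p)" for g
  proof -
    have [measurable]: "g \<in> borel_measurable borel"
      and gi: "integrable lborel (\<lambda>x. cmod (g x) powr p)"
      using g by (auto simp: Lp_carrier_real_iff p1)
    have intQ: "integrable lborel (indicator (Q j) :: 'a \<Rightarrow> real)" if "j \<in> J" for j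
      using Qm[OF that] Qfin[OF that] by (intro integrable_real_indicator) auto
    have intp: "integrable lborel (\<lambda>x. indicator (Q j) x * cmod (g x) powr p)" if "j \<in> J" for j
      using integrable_real_mult_indicator[OF _ gi, of "Q j"] Qm[OF that] by (simp add: mult.commute)
    have ind: "(\<Sum>j\<in>J. c j * indicator (Q j) x) = (if \<Phi> x \<in> J then c (\<Phi> x) else (0::real))" for c x
    proof -
      have "(\<Sum>j\<in>J. c j * indicator (Q j) x) = (\<Sum>j\<in>J. if j = \<Phi> x then c j else 0)"
        by (intro sum.cong) (auto simp: Q_def)
      then show ?thesis using finJ by (simp add: sum.delta')
    qed
    have "?N (P g) powr p = (LINT x|lborel. cmod (P g x) powr p)"
      using PL Lp_carrier_measurable by (intro Lp_norm_powr p1) blast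
    also have "\<dots> = (LINT x|lborel. (\<Sum>j\<in>J. cmod (l j g) powr p * indicator (Q j) x))"
      by (intro Bochner_Integration.integral_cong) (auto simp: Pval ind)
    also have "\<dots> = (\<Sum>j\<in>J. cmod (l j g) powr p * measure lborel (Q j))"
      using intQ Qm by (subst Bochner_Integration.integral_sum) (auto intro!: sum.cong)
    also have "\<dots> \<le> (\<Sum>j\<in>J. LINT x|lborel. indicator (Q j) x * cmod (g x) powr p)"
      unfolding l_def by (intro sum_mono average_powr_le g Qm Qfin)
    also have "\<dots> = (LINT x|lborel. (\<Sum>j\<in>J. indicator (Q j) x * cmod (g x) powr p))"
      by (rule Bochner_Integration.integral_sum[symmetric]) (rule intp)
    also have "\<dots> \<le> (LINT x|lborel. cmod (g x) powr p)"
    proof (rule integral_mono)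
      show "(\<Sum>j\<in>J. indicator (Q j) x * cmod (g x) powr p) \<le> cmod (g x) powr p" for x
        using ind[of "\<lambda>_. cmod (g x) powr p" x] by (simp add: mult.commute split: if_splits)
    qed (use gi intp in auto)
    also have "\<dots> = ?N g powr p" by (simp add: Lp_norm_powr p1)
    finally show ?thesis
      using p1 by (meson Lp_norm_nonneg linorder_not_le powr_less_mono2 less_le_trans zero_less_one)
  qed
  have close: "?N (\<lambda>x. g x - P g x) \<le> \<epsilon>" if g: "g \<in> Y" for g
  proof -
    have gL: "g \<in> Lp_carrier (ennreal p)" using g Y by auto
    have sL: "s g \<in> Lp_carrier (ennreal p)" using s g by auto
    have dL: "(\<lambda>x. s g x - g x) \<in> Lp_carrier (ennreal p)" by (intro Lp_diff p1 sL gL)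
    \<comment> \<open>On an atom of measure 0 the average is 0 by division by zero, whatever value
      \<open>s g\<close> takes there. These finitely many atoms are discarded as null sets, and P
      fixes \<open>s g\<close> elsewhere.\<close>
    have "AE x in lborel. \<forall>j\<in>J. measure lborel (Q j) = 0 \<longrightarrow> x \<notin> Q j"
    proof (intro AE_finite_allI finJ)
      fix j assume j: "j \<in> J"
      show "AE x in lborel. measure lborel (Q j) = 0 \<longrightarrow> x \<notin> Q j"
      proof (cases "measure lborel (Q j) = 0")
        case True
        then have "Q j \<in> null_sets lborel"
          using Qm[OF j] Qfin[OF j] by (intro null_setsI) (auto simp: measure_def enn2real_eq_0_iff)
        then show ?thesis by (auto dest: AE_not_in)
      qed simp
    qed
    then have AE: "AE x in lborel. s g x = P (s g) x"
    proof eventually_elim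
      case (elim x)
      show ?case
      proof (cases "\<Phi> x \<in> J")
        case True
        then have ne: "measure lborel (Q (\<Phi> x)) \<noteq> 0" using elim by (auto simp: Q_def)
        have "(LINT y|lborel. indicator (Q (\<Phi> x)) y * s g y) = (LINT y|lborel. indicator (Q (\<Phi> x)) y *\<^sub>R s g x)"
        proof (intro Bochner_Integration.integral_cong refl)
          fix y
          show "indicator (Q (\<Phi> x)) y * s g y = indicator (Q (\<Phi> x)) y *\<^sub>R s g x"
            using Qeq[OF True] g by (auto simp: indicator_def \<Phi>_def)
        qed
        also have "\<dots> = measure lborel (Q (\<Phi> x)) *\<^sub>R s g x"
          using Qm[OF True] Qfin[OF True] by (subst Bochner_Integration.integral_scaleR_left) auto
        finally show ?thesis using True ne by (simp add: Pval l_def scaleR_conv_of_real)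
      next
        case False
        then have "s g x = 0" using g by (auto simp: J_def)
        then show ?thesis using False by (simp add: Pval)
      qed
    qed
    have lin: "P (\<lambda>x. s g x - g x) x = P (s g) x - P g x" for x
      unfolding P_def sum_subtractf[symmetric]
      by (intro sum.cong refl) (simp add: dual_diff[OF lD sL gL] left_diff_distrib)
    \<comment> \<open>Since P fixes s = s g almost everywhere, g - P g = (g - s) + P (s - g) there.
      As P is a contraction, both summands have norm below \<epsilon> / 2.\<close>
    let ?d = "\<lambda>x. (g x - s g x) + P (\<lambda>x. s g x - g x) x"
    have "?N (\<lambda>x. g x - P g x) \<le> ?N ?d"
    proof (rule Lp_dominated(2)[OF p1])
      show "(\<lambda>x. g x - P g x) \<in> borel_measurable borel"
        by (rule Lp_carrier_measurable, rule Lp_diff(1)[OF p1 gL PL])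
      show "?d \<in> Lp_carrier (ennreal p)"
        by (intro Lp_triangle Lp_diff p1 gL sL PL)
      show "AE x in lborel. cmod (g x - P g x) \<le> cmod (?d x)"
        using AE by eventually_elim (simp add: lin)
    qed
    also have "\<dots> \<le> ?N (\<lambda>x. g x - s g x) + ?N (P (\<lambda>x. s g x - g x))"
      by (intro Lp_triangle Lp_diff p1 gL sL PL)
    also have "?N (P (\<lambda>x. s g x - g x)) \<le> ?N (\<lambda>x. s g x - g x)" by (rule contr[OF dL])
    also have "?N (\<lambda>x. s g x - g x) = ?N (\<lambda>x. g x - s g x)"
      using Lp_scale(2)[OF p1 Lp_diff(1)[OF p1 sL gL], of "-1"] by simp
    finally show ?thesis using s(3)[OF g] by simp
  qed
  show ?thesis
    by (rule that[of J l u])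
      (use finJ lD uL contr close in \<open>auto simp: P_def[abs_def]\<close>)
qed

section \<open>Comparison of two nuclear representations\<close>

lemma nuclear_rep_summable:
  assumes "0 < r" "r \<le> 1" and rep: "nuclear_rep r (Lp (ennreal p)) (Lp (ennreal p)) T e y"
  shows "summable (\<lambda>i. dual_norm (Lp (ennreal p)) (e i) * Lp_norm (ennreal p) (y i))"
proof (rule summable_of_summable_powr[OF assms(1,2)])
  have e: "e i \<in> dual_space (Lp (ennreal p))" for i using rep by (simp add: nuclear_rep_def)
  show "0 \<le> dual_norm (Lp (ennreal p)) (e i) * Lp_norm (ennreal p) (y i)" for i
    using dual_norm_nonneg[OF p1 e] by simp
  show "summable (\<lambda>i. (dual_norm (Lp (ennreal p)) (e i) * Lp_norm (ennreal p) (y i)) powr r)"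
    using rep dual_norm_nonneg[OF p1 e] by (simp add: nuclear_rep_def powr_mult)
qed

text \<open>With P = \<Sum>_j l_j(.) u_j, the comparison number \<Sum>_j l_j(T u_j) is the trace of
  f \<mapsto> P (T f), an operator of finite rank. Its distance to t is estimated through e_i(y_i -
  P y_i): closeness serves for i < N, and beyond N the contraction property gives norm at most twice
  that of y_i, whence the factor 2.\<close>

lemma nuclear_sum_finite_rank_error:
  assumes "0 < r" "r \<le> 1" and T: "linear_operator (Lp (ennreal p)) (Lp (ennreal p)) T"
    and rep: "nuclear_rep r (Lp (ennreal p)) (Lp (ennreal p)) T e y"
    and sums: "(\<lambda>i. e i (y i)) sums t"
    and J: "finite J" "\<And>j. j \<in> J \<Longrightarrow> l j \<in> dual_space (Lp (ennreal p))"
      "\<And>j. j \<in> J \<Longrightarrow> u j \<in> Lp_carrier (ennreal p)"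
    and contr: "\<And>g. g \<in> Lp_carrier (ennreal p) \<Longrightarrow>
       Lp_norm (ennreal p) (\<lambda>x. \<Sum>j\<in>J. l j g * u j x) \<le> Lp_norm (ennreal p) g"
    and close: "\<And>i. i < N \<Longrightarrow> Lp_norm (ennreal p) (\<lambda>x. y i x - (\<Sum>j\<in>J. l j (y i) * u j x)) \<le> \<epsilon>"
  shows "cmod (t - (\<Sum>j\<in>J. l j (T (u j)))) \<le>
    \<epsilon> * (\<Sum>i<N. dual_norm (Lp (ennreal p)) (e i)) +
    2 * (\<Sum>i. dual_norm (Lp (ennreal p)) (e (i + N)) * Lp_norm (ennreal p) (y (i + N)))"
proof -
  let ?N = "Lp_norm (ennreal p)" and ?D = "dual_norm (Lp (ennreal p))"
  have e: "\<And>i. e i \<in> dual_space (Lp (ennreal p))" and y: "\<And>i. y i \<in> Lp_carrier (ennreal p)"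
    and lim: "\<And>f. f \<in> Lp_carrier (ennreal p) \<Longrightarrow> (\<lambda>k. ?N (\<lambda>x. T f x - (\<Sum>i<k. e i f * y i x))) \<longlonglongrightarrow> 0"
    using rep by (auto simp: nuclear_rep_def)
  have Tu: "T (u j) \<in> Lp_carrier (ennreal p)" if "j \<in> J" for j
    using T J(3)[OF that] by (auto simp: linear_operator_def)
  define Py where "Py i x = (\<Sum>j\<in>J. l j (y i) * u j x)" for i x
  have PyL: "Py i \<in> Lp_carrier (ennreal p)" for i
    using Lp_sum[OF p1 J(1), of "\<lambda>j x. l j (y i) * u j x"] J(3) unfolding Py_def[abs_def]
    by (auto intro!: Lp_scale p1)
  \<comment> \<open>The representation expands T (u j) as a series converging in norm, and the
    bounded functional \<open>l j\<close> may be applied term by term.\<close>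
  have "(\<lambda>i. e i (u j) * l j (y i)) sums l j (T (u j))" if j: "j \<in> J" for j
    unfolding sums_def
  proof (rule Lim_null[THEN iffD2], rule tendsto_norm_zero_cancel, rule tendsto_sandwich[OF _ _ tendsto_const])
    let ?S = "\<lambda>k x. \<Sum>i<k. e i (u j) * y i x"
    have S: "?S k \<in> Lp_carrier (ennreal p)" for k
      using Lp_sum[OF p1, of "{..<k}" "\<lambda>i x. e i (u j) * y i x"] y by (auto intro!: Lp_scale p1)
    have "cmod ((\<Sum>i<k. e i (u j) * l j (y i)) - l j (T (u j))) \<le> ?D (l j) * ?N (\<lambda>x. T (u j) x - ?S k x)" for k
    proof -
      have "(\<Sum>i<k. e i (u j) * l j (y i)) = l j (?S k)"
        by (rule dual_sum[OF J(2)[OF j], symmetric]) (auto intro: y)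
      then have "cmod ((\<Sum>i<k. e i (u j) * l j (y i)) - l j (T (u j))) = cmod (l j (\<lambda>x. T (u j) x - ?S k x))"
        by (simp add: dual_diff[OF J(2)[OF j] Tu[OF j] S] norm_minus_commute)
      also have "\<dots> \<le> ?D (l j) * ?N (\<lambda>x. T (u j) x - ?S k x)"
        by (intro dual_bound p1 J(2) j Lp_diff Tu S)
      finally show ?thesis .
    qed
    then show "\<forall>\<^sub>F k in sequentially. cmod ((\<Sum>i<k. e i (u j) * l j (y i)) - l j (T (u j)))
      \<le> ?D (l j) * ?N (\<lambda>x. T (u j) x - ?S k x)" by simp
    show "(\<lambda>k. ?D (l j) * ?N (\<lambda>x. T (u j) x - ?S k x)) \<longlonglongrightarrow> 0"
      using tendsto_mult_left[OF lim[OF J(3)[OF j]], of "?D (l j)"] by simp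
  qed auto
  then have "(\<lambda>i. \<Sum>j\<in>J. e i (u j) * l j (y i)) sums (\<Sum>j\<in>J. l j (T (u j)))"
    by (rule sums_sum)
  moreover have "(\<Sum>j\<in>J. e i (u j) * l j (y i)) = e i (Py i)" for i
    unfolding Py_def[abs_def] by (subst dual_sum[OF e J(1) J(3)]) (auto simp: mult.commute)
  ultimately have "(\<lambda>i. e i (y i) - e i (Py i)) sums (t - (\<Sum>j\<in>J. l j (T (u j))))"
    using sums by (intro sums_diff) auto
  then have diff: "(\<lambda>i. e i (\<lambda>x. y i x - Py i x)) sums (t - (\<Sum>j\<in>J. l j (T (u j))))"
    by (simp add: dual_diff[OF e y PyL])
  \<comment> \<open>A summable majorant of the differences, switching at N from the closeness
    estimate to the contraction estimate.\<close>
  define b where "b i = (if i < N then \<epsilon> * ?D (e i) else 2 * (?D (e i) * ?N (y i)))" for i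
  have bound: "cmod (e i (\<lambda>x. y i x - Py i x)) \<le> b i" for i
  proof -
    have "cmod (e i (\<lambda>x. y i x - Py i x)) \<le> ?D (e i) * ?N (\<lambda>x. y i x - Py i x)"
      by (intro dual_bound p1 e Lp_diff y PyL)
    also have "\<dots> \<le> b i"
    proof (cases "i < N")
      case True
      then have "?N (\<lambda>x. y i x - Py i x) \<le> \<epsilon>" using close[OF True] by (simp add: Py_def)
      then have "?D (e i) * ?N (\<lambda>x. y i x - Py i x) \<le> ?D (e i) * \<epsilon>"
        using dual_norm_nonneg[OF p1 e] by (rule mult_left_mono)
      then show ?thesis using True by (simp add: b_def mult.commute)
    next
      case False
      have "?N (\<lambda>x. y i x - Py i x) \<le> ?N (y i) + ?N (Py i)" by (intro Lp_diff p1 y PyL)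
      also have "?N (Py i) \<le> ?N (y i)" unfolding Py_def[abs_def] by (rule contr[OF y])
      finally have "?D (e i) * ?N (\<lambda>x. y i x - Py i x) \<le> ?D (e i) * (2 * ?N (y i))"
        using dual_norm_nonneg[OF p1 e] by (intro mult_left_mono) auto
      then show ?thesis using False by (simp add: b_def)
    qed
    finally show ?thesis .
  qed
  have tail: "summable (\<lambda>i. ?D (e (i + N)) * ?N (y (i + N)))"
    using nuclear_rep_summable[OF assms(1,2) rep]
    by (subst summable_iff_shift[of "\<lambda>i. ?D (e i) * ?N (y i)"])
  have bN: "(\<lambda>i. b (i + N)) = (\<lambda>i. 2 * (?D (e (i + N)) * ?N (y (i + N))))"
    by (simp add: b_def)
  have bsum: "summable b"
    by (subst summable_iff_shift[of _ N, symmetric]) (unfold bN, intro summable_mult tail)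
  have "cmod (t - (\<Sum>j\<in>J. l j (T (u j)))) \<le> suminf b"
    by (rule norm_sums_le[OF diff summable_sums[OF bsum] bound])
  also have "suminf b = (\<Sum>i. b (i + N)) + (\<Sum>i<N. b i)"
    by (rule suminf_split_initial_segment[OF bsum])
  also have "(\<Sum>i<N. b i) = \<epsilon> * (\<Sum>i<N. ?D (e i))" by (simp add: b_def sum_distrib_left)
  also have "(\<Sum>i. b (i + N)) = 2 * (\<Sum>i. ?D (e (i + N)) * ?N (y (i + N)))"
    unfolding bN by (rule suminf_mult[OF tail])
  finally show ?thesis by simp
qed

text \<open>A single operator of finite rank is chosen for the initial vectors of both
  representations, so both sums are compared with the same number.\<close>

lemma nuclear_sum_unique:
  fixes T :: "('a::euclidean_space \<Rightarrow> complex) \<Rightarrow> 'a \<Rightarrow> complex"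
  assumes r: "0 < r" "r \<le> 1" and T: "linear_operator (Lp (ennreal p)) (Lp (ennreal p)) T"
    and rep: "nuclear_rep r (Lp (ennreal p)) (Lp (ennreal p)) T e y" "(\<lambda>i. e i (y i)) sums t"
    and rep': "nuclear_rep r (Lp (ennreal p)) (Lp (ennreal p)) T e' y'" "(\<lambda>i. e' i (y' i)) sums t'"
  shows "t = t'"
proof -
  let ?N = "Lp_norm (ennreal p)" and ?D = "dual_norm (Lp (ennreal p))"
  have "cmod (t - t') \<le> \<delta>" if "0 < \<delta>" for \<delta>
  proof -
    let ?R = "\<lambda>N. \<Sum>i. ?D (e (i + N)) * ?N (y (i + N))"
    let ?R' = "\<lambda>N. \<Sum>i. ?D (e' (i + N)) * ?N (y' (i + N))"
    have "(\<lambda>N. ?R N + ?R' N) \<longlonglongrightarrow> 0 + 0"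
      by (intro tendsto_add suminf_exist_split2 nuclear_rep_summable[OF r rep(1)] nuclear_rep_summable[OF r rep'(1)])
    then have "eventually (\<lambda>N. ?R N + ?R' N < \<delta> / 4) sequentially"
      using that by (intro order_tendstoD) auto
    \<comment> \<open>The order of choices matters: N makes both tails small, \<epsilon> then
      depends on N through the finitely many functional norms in S, and the finite-rank operator is
      chosen last.\<close>
    then obtain N where N: "?R N + ?R' N < \<delta> / 4" by (auto simp: eventually_sequentially)
    define S where "S = (\<Sum>i<N. ?D (e i)) + (\<Sum>i<N. ?D (e' i))"
    have S: "0 \<le> S" unfolding S_def
      using rep(1) rep'(1) by (intro add_nonneg_nonneg sum_nonneg dual_norm_nonneg p1) (auto simp: nuclear_rep_def)
    \<comment> \<open>Using S + 1 keeps the denominator positive even when S = 0.\<close>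
    define \<epsilon> where "\<epsilon> = \<delta> / (2 * (S + 1))"
    have \<epsilon>: "0 < \<epsilon>" "\<epsilon> * S \<le> \<delta> / 2" using S that by (auto simp: \<epsilon>_def field_simps)
    have "finite (y ` {..<N} \<union> y' ` {..<N})" "y ` {..<N} \<union> y' ` {..<N} \<subseteq> Lp_carrier (ennreal p)"
      using rep(1) rep'(1) by (auto simp: nuclear_rep_def)
    then obtain J :: "(('a \<Rightarrow> complex) \<Rightarrow> complex) set" and l u where J: "finite J" "\<And>j. j \<in> J \<Longrightarrow> l j \<in> dual_space (Lp (ennreal p))"
      "\<And>j. j \<in> J \<Longrightarrow> u j \<in> Lp_carrier (ennreal p)"
      "\<And>g. g \<in> Lp_carrier (ennreal p) \<Longrightarrow> ?N (\<lambda>x. \<Sum>j\<in>J. l j g * u j x) \<le> ?N g"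
      and close: "\<And>g. g \<in> y ` {..<N} \<union> y' ` {..<N} \<Longrightarrow> ?N (\<lambda>x. g x - (\<Sum>j\<in>J. l j g * u j x)) \<le> \<epsilon>"
      by (rule finite_rank_approximation[OF _ _ \<epsilon>(1)]) blast
    let ?K = "\<Sum>j\<in>J. l j (T (u j))"
    have "cmod (t - ?K) \<le> \<epsilon> * (\<Sum>i<N. ?D (e i)) + 2 * ?R N"
      by (rule nuclear_sum_finite_rank_error[OF r T rep J]) (auto intro: close)
    moreover have "cmod (t' - ?K) \<le> \<epsilon> * (\<Sum>i<N. ?D (e' i)) + 2 * ?R' N"
      by (rule nuclear_sum_finite_rank_error[OF r T rep' J]) (auto intro: close)
    ultimately have "cmod (t - ?K) + cmod (t' - ?K) \<le> \<epsilon> * S + 2 * (?R N + ?R' N)"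
      by (simp add: S_def algebra_simps)
    also have "\<dots> \<le> \<delta> / 2 + 2 * (\<delta> / 4)"
      using \<epsilon>(2) N by (intro add_mono mult_left_mono) auto
    finally show ?thesis
      using norm_triangle_ineq4[of "t - ?K" "t' - ?K"] by simp
  qed
  then have "cmod (t - t') \<le> 0" by (rule field_le_epsilon[where y = 0, simplified])
  then show ?thesis by simp
qed

lemma nuclear_trace_eqI:
  assumes "0 < r" "r \<le> 1" "linear_operator (Lp (ennreal p)) (Lp (ennreal p)) T"
    and "nuclear_rep r (Lp (ennreal p)) (Lp (ennreal p)) T e y" "(\<lambda>i. e i (y i)) sums t"
  shows "nuclear_trace r (Lp (ennreal p)) T = t"
  unfolding nuclear_trace_def
proof (rule the_equality)
  show "\<exists>e y. nuclear_rep r (Lp (ennreal p)) (Lp (ennreal p)) T e y \<and> (\<lambda>i. e i (y i)) sums t"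
    using assms(4,5) by blast
  fix t' assume "\<exists>e y. nuclear_rep r (Lp (ennreal p)) (Lp (ennreal p)) T e y \<and> (\<lambda>i. e i (y i)) sums t'"
  then obtain e' y' where "nuclear_rep r (Lp (ennreal p)) (Lp (ennreal p)) T e' y'" "(\<lambda>i. e' i (y' i)) sums t'"
    by blast
  then show "t' = t" by (rule nuclear_sum_unique[OF assms(1-3) _ _ assms(4,5)])
qed

end

section \<open>Hermite functions\<close>

text \<open>The three-term recurrence of the physicists' Hermite polynomials. It gives derivatives
  and growth bounds by induction, where the Rodrigues formula would require iterated derivatives;
  \<open>hermite_poly_eq\<close> identifies the two.\<close>

fun hermite_rec :: "nat \<Rightarrow> real \<Rightarrow> real" where
  "hermite_rec 0 t = 1"
| "hermite_rec (Suc 0) t = 2 * t"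
| "hermite_rec (Suc (Suc k)) t = 2 * t * hermite_rec (Suc k) t - 2 * real (Suc k) * hermite_rec k t"

text \<open>A uniform form of the recurrence: at k = 0 the truncated index \<open>k - 1\<close> is
  harmless, since its coefficient vanishes.\<close>

lemma hermite_rec_Suc:
  "hermite_rec (Suc k) t = 2 * t * hermite_rec k t - 2 * real k * hermite_rec (k - 1) t"
  by (cases k) auto

lemma hermite_rec_has_derivative:
  "(hermite_rec k has_real_derivative 2 * real k * hermite_rec (k - 1) t) (at t)"
proof (induction k rule: induct_nat_012)
  case 0
  have "hermite_rec 0 = (\<lambda>t. 1)" by auto
  then show ?case by simp
next
  case 1
  have "hermite_rec (Suc 0) = (\<lambda>t. 2 * t)" by auto
  then show ?case by (auto intro!: derivative_eq_intros)
next
  case (ge2 k)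
  have eq: "hermite_rec (Suc (Suc k)) = (\<lambda>t. 2 * t * hermite_rec (Suc k) t - 2 * real (Suc k) * hermite_rec k t)"
    by auto
  show ?case unfolding eq
    \<comment> \<open>Differentiation leaves 2 H_{k+1} + 2 (k+1) (2 t H_k - 2 k H_{k-1}); the
      recurrence turns the bracket into H_{k+1}.\<close>
    by (rule derivative_eq_intros ge2 refl)+ (simp add: hermite_rec_Suc[of k] algebra_simps)
qed

lemmas hermite_rec_derivs [derivative_intros] = DERIV_chain2[OF hermite_rec_has_derivative]

lemma isCont_hermite_rec: "isCont (hermite_rec k) t"
  using hermite_rec_has_derivative by (rule DERIV_isCont)

lemma hermite_rec_measurable [measurable]: "hermite_rec k \<in> borel_measurable borel"
  by (intro borel_measurable_continuous_onI continuous_at_imp_continuous_on ballI isCont_hermite_rec)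

text \<open>The derivative formula and the recurrence combine into a raising relation. It is the
  inductive step for the Rodrigues formula and one half of the product rule behind the norm
  recursion.\<close>

lemma hermite_rec_exp_has_derivative:
  "((\<lambda>t. hermite_rec k t * exp (- t\<^sup>2)) has_real_derivative - hermite_rec (Suc k) t * exp (- t\<^sup>2)) (at t)"
  by (auto intro!: derivative_eq_intros simp: hermite_rec_Suc algebra_simps)

lemma hermite_poly_eq: "hermite_poly k t = hermite_rec k t"
proof -
  have "(deriv ^^ k) (\<lambda>s. exp (- s\<^sup>2)) = (\<lambda>t. (- 1) ^ k * (hermite_rec k t * exp (- t\<^sup>2)))"
  proof (induction k)
    case (Suc k)
    have "deriv (\<lambda>t. (- 1) ^ k * (hermite_rec k t * exp (- t\<^sup>2))) t =
       (- 1) ^ k * (- hermite_rec (Suc k) t * exp (- t\<^sup>2))" for t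
      by (intro DERIV_imp_deriv DERIV_cmult hermite_rec_exp_has_derivative)
    then show ?case by (simp add: Suc fun_eq_iff)
  qed simp
  then show ?thesis
    by (simp add: hermite_poly_def exp_minus field_simps flip: power_mult_distrib)
qed

text \<open>From |2 t| \<le> 1 + t^2 and 1 + x \<le> exp x. It lets the factor 2 t of the recurrence
  be absorbed into an arbitrarily weak exponential.\<close>

lemma abs_double_le_exp_square:
  fixes a t :: real
  assumes "0 < a"
  shows "\<bar>2 * t\<bar> \<le> max 1 (1 / a) * exp (a * t\<^sup>2)"
proof -
  have "\<bar>2 * t\<bar> \<le> 1 + t\<^sup>2" using zero_le_power2[of "\<bar>t\<bar> - 1"] by (simp add: power2_diff)
  also have "\<dots> \<le> max 1 (1 / a) * (1 + a * t\<^sup>2)"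
  proof -
    have "t\<^sup>2 = 1 / a * (a * t\<^sup>2)" using assms by simp
    also have "\<dots> \<le> max 1 (1 / a) * (a * t\<^sup>2)" using assms by (intro mult_right_mono) auto
    finally show ?thesis by (simp add: distrib_left)
  qed
  also have "\<dots> \<le> max 1 (1 / a) * exp (a * t\<^sup>2)"
    by (intro mult_left_mono exp_ge_add_one_self) auto
  finally show ?thesis .
qed

text \<open>In the inductive step exp (a t^2) is split into two halves, one for 2 t and one for the
  polynomial of order k + 1; this is why a varies in the induction.\<close>

lemma hermite_rec_bound:
  assumes "0 < a"
  shows "\<exists>C\<ge>0. \<forall>t. \<bar>hermite_rec k t\<bar> \<le> C * exp (a * t\<^sup>2)"
  using assms
proof (induction k arbitrary: a rule: induct_nat_012)
  case 0
  then show ?case by (intro exI[of _ 1]) auto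
next
  case 1
  then show ?case
    using abs_double_le_exp_square[of a] by (intro exI[of _ "max 1 (1 / a)"]) auto
next
  case (ge2 k)
  define A where "A = max 1 (1 / (a / 2))"
  have A: "0 \<le> A" "\<And>t. \<bar>2 * t\<bar> \<le> A * exp (a / 2 * t\<^sup>2)"
    unfolding A_def using abs_double_le_exp_square[of "a / 2"] ge2(3) by auto
  obtain B where B: "0 \<le> B" "\<And>t. \<bar>hermite_rec (Suc k) t\<bar> \<le> B * exp (a / 2 * t\<^sup>2)"
    using ge2(2)[of "a / 2"] ge2(3) by auto
  obtain C where C: "0 \<le> C" "\<And>t. \<bar>hermite_rec k t\<bar> \<le> C * exp (a * t\<^sup>2)"
    using ge2(1)[of a] ge2(3) by auto
  have "\<bar>hermite_rec (Suc (Suc k)) t\<bar> \<le> (A * B + 2 * real (Suc k) * C) * exp (a * t\<^sup>2)" for t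
  proof -
    have "\<bar>hermite_rec (Suc (Suc k)) t\<bar> \<le> \<bar>2 * t\<bar> * \<bar>hermite_rec (Suc k) t\<bar> + 2 * real (Suc k) * \<bar>hermite_rec k t\<bar>"
      unfolding hermite_rec.simps
      by (rule order_trans[OF abs_triangle_ineq4]) (simp add: abs_mult)
    also have "\<dots> \<le> (A * exp (a / 2 * t\<^sup>2)) * (B * exp (a / 2 * t\<^sup>2)) + 2 * real (Suc k) * (C * exp (a * t\<^sup>2))"
      using A B C by (intro add_mono mult_mono) auto
    also have "(A * exp (a / 2 * t\<^sup>2)) * (B * exp (a / 2 * t\<^sup>2)) = A * B * (exp (a / 2 * t\<^sup>2) * exp (a / 2 * t\<^sup>2))"
      by (simp only: mult_ac)
    also have "exp (a / 2 * t\<^sup>2) * exp (a / 2 * t\<^sup>2) = exp (a * t\<^sup>2)"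
      by (simp flip: exp_add)
    finally show ?thesis by (simp add: algebra_simps)
  qed
  then show ?case using A B C by (intro exI[of _ "A * B + 2 * real (Suc k) * C"]) auto
qed

section \<open>Gaussian integrals and the normalisation in one variable\<close>

lemma has_bochner_integral_gaussian:
  assumes "0 < a"
  shows "has_bochner_integral lborel (\<lambda>t. exp (- a * t\<^sup>2)) (sqrt (pi / a))"
proof -
  \<comment> \<open>The Gaussian is a multiple of the centred normal density of variance 1 / (2 a),
    whose total mass is 1.\<close>
  let ?\<sigma> = "1 / sqrt (2 * a)"
  have sq: "2 * ?\<sigma>\<^sup>2 = 1 / a" using assms by (simp add: power_divide)
  have "2 * pi * ?\<sigma>\<^sup>2 = pi / a" using arg_cong[OF sq, of "\<lambda>u. pi * u"] by simp
  then have eq: "(\<lambda>t. exp (- a * t\<^sup>2)) = (\<lambda>t. sqrt (pi / a) * normal_density 0 ?\<sigma> t)"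
    using assms sq by (auto simp: normal_density_def fun_eq_iff)
  have "0 < ?\<sigma>" using assms by simp
  then show ?thesis unfolding eq has_bochner_integral_iff by simp
qed

lemma hermite_rec_product_bound:
  "\<exists>C\<ge>0. \<forall>t. \<bar>hermite_rec j t * hermite_rec k t * exp (- t\<^sup>2)\<bar> \<le> C * exp (- (1 / 2) * t\<^sup>2)"
proof -
  \<comment> \<open>Growth rate 1/4 for each factor leaves 1/4 + 1/4 - 1 = -1/2 in the
    exponent.\<close>
  obtain A B where AB: "0 \<le> A" "\<And>t. \<bar>hermite_rec j t\<bar> \<le> A * exp (1 / 4 * t\<^sup>2)"
    "0 \<le> B" "\<And>t. \<bar>hermite_rec k t\<bar> \<le> B * exp (1 / 4 * t\<^sup>2)"
    using hermite_rec_bound[of "1 / 4" j] hermite_rec_bound[of "1 / 4" k] by auto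
  have "\<bar>hermite_rec j t * hermite_rec k t * exp (- t\<^sup>2)\<bar> \<le> A * B * exp (- (1 / 2) * t\<^sup>2)" for t
  proof -
    have "\<bar>hermite_rec j t * hermite_rec k t * exp (- t\<^sup>2)\<bar> \<le>
      (A * exp (1 / 4 * t\<^sup>2)) * (B * exp (1 / 4 * t\<^sup>2)) * exp (- t\<^sup>2)"
      unfolding abs_mult abs_exp_cancel using AB by (intro mult_mono) auto
    also have "\<dots> = A * B * (exp (1 / 4 * t\<^sup>2) * exp (1 / 4 * t\<^sup>2) * exp (- t\<^sup>2))"
      by (simp only: mult_ac)
    also have "exp (1 / 4 * t\<^sup>2) * exp (1 / 4 * t\<^sup>2) * exp (- t\<^sup>2) = exp (- (1 / 2) * t\<^sup>2)"
      by (simp flip: exp_add)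
    finally show ?thesis .
  qed
  then show ?thesis using AB by (intro exI[of _ "A * B"]) auto
qed

lemma integrable_hermite_rec_product:
  "integrable lborel (\<lambda>t. hermite_rec j t * hermite_rec k t * exp (- t\<^sup>2))"
proof -
  obtain C where C: "0 \<le> C"
    "\<And>t. \<bar>hermite_rec j t * hermite_rec k t * exp (- t\<^sup>2)\<bar> \<le> C * exp (- (1 / 2) * t\<^sup>2)"
    using hermite_rec_product_bound by blast
  have "integrable lborel (\<lambda>t. C * exp (- (1 / 2) * t\<^sup>2))"
    using has_bochner_integral_gaussian[of "1 / 2"] by (intro integrable_mult_right) (auto simp: has_bochner_integral_iff)
  then show ?thesis
    by (rule Bochner_Integration.integrable_bound) (use C in auto)
qed

text \<open>The filter is left general to serve for the boundary terms at both ends of the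
  line.\<close>

lemma hermite_rec_product_tendsto_0:
  assumes "filterlim (\<lambda>t::real. t\<^sup>2) at_top F"
  shows "((\<lambda>t. hermite_rec j t * hermite_rec k t * exp (- t\<^sup>2)) \<longlongrightarrow> 0) F"
proof -
  obtain C where C: "0 \<le> C"
    "\<And>t. \<bar>hermite_rec j t * hermite_rec k t * exp (- t\<^sup>2)\<bar> \<le> C * exp (- (1 / 2) * t\<^sup>2)"
    using hermite_rec_product_bound by blast
  have "((\<lambda>u. C * exp (- (1 / 2) * u)) \<longlongrightarrow> 0) at_top" by real_asymp
  then have lim: "((\<lambda>t. C * exp (- (1 / 2) * t\<^sup>2)) \<longlongrightarrow> 0) F"
    using assms by (rule filterlim_compose)
  show ?thesis
    by (rule Lim_null_comparison[OF _ lim]) (use C in auto)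
qed

text \<open>The integrand below is the derivative of \<open>H\<^sub>k\<^sub>+\<^sub>1 H\<^sub>k exp (-t\<^sup>2)\<close>, which vanishes at infinity.\<close>

lemma integral_hermite_rec_square_Suc:
  "(LINT t|lborel. hermite_rec (Suc k) t * hermite_rec (Suc k) t * exp (- t\<^sup>2)) =
   2 * real (Suc k) * (LINT t|lborel. hermite_rec k t * hermite_rec k t * exp (- t\<^sup>2))"
proof -
  let ?F = "\<lambda>t. hermite_rec (Suc k) t * hermite_rec k t * exp (- t\<^sup>2)"
  let ?f = "\<lambda>t. 2 * real (Suc k) * (hermite_rec k t * hermite_rec k t * exp (- t\<^sup>2)) -
    hermite_rec (Suc k) t * hermite_rec (Suc k) t * exp (- t\<^sup>2)"
  have deriv: "(?F has_vector_derivative ?f t) (at t)" for t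
  proof -
    \<comment> \<open>The exponential is grouped with H_k: differentiating H_{k+1} lowers it to 2
      (k+1) H_k, while differentiating the group raises it to -H_{k+1} exp (-t^2).\<close>
    have "((\<lambda>t. hermite_rec (Suc k) t * (hermite_rec k t * exp (- t\<^sup>2))) has_real_derivative ?f t) (at t)"
      by (rule derivative_eq_intros hermite_rec_has_derivative hermite_rec_exp_has_derivative refl)+
        (simp add: algebra_simps)
    then show ?thesis by (simp add: has_real_derivative_iff_has_vector_derivative mult.assoc)
  qed
  have int: "integrable lborel ?f"
    by (intro Bochner_Integration.integrable_diff integrable_mult_right integrable_hermite_rec_product)
  have "(LBINT t=-\<infinity>..\<infinity>. ?f t) = 0 - 0"
  proof (rule interval_integral_FTC_integrable[where F = ?F])
    show "isCont ?f t" for t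
      by (intro continuous_intros isCont_hermite_rec)
    show "set_integrable lborel (einterval (-\<infinity>) \<infinity>) ?f"
      using int by (simp add: set_integrable_def)
    show "((?F \<circ> real_of_ereal) \<longlongrightarrow> 0) (at_right (-\<infinity>))"
      unfolding ereal_tendsto_simps by (intro hermite_rec_product_tendsto_0) real_asymp
    show "((?F \<circ> real_of_ereal) \<longlongrightarrow> 0) (at_left \<infinity>)"
      unfolding ereal_tendsto_simps by (intro hermite_rec_product_tendsto_0) real_asymp
  qed (use deriv in auto)
  then have "integral\<^sup>L lborel ?f = 0"
    by (simp add: interval_lebesgue_integral_def set_lebesgue_integral_def)
  then show ?thesis
    by (simp add: integrable_hermite_rec_product)
qed

lemma integral_hermite_rec_square:
  "(LINT t|lborel. hermite_rec k t * hermite_rec k t * exp (- t\<^sup>2)) = 2 ^ k * fact k * sqrt pi"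
proof (induction k)
  case 0
  then show ?case using has_bochner_integral_gaussian[of 1] by (simp add: has_bochner_integral_iff)
next
  case (Suc k)
  then show ?case by (simp add: integral_hermite_rec_square_Suc)
qed

lemma hermite_fun1_measurable [measurable]: "hermite_fun1 k \<in> borel_measurable borel"
  unfolding hermite_fun1_def[abs_def] hermite_poly_eq by measurable

lemma nn_integral_hermite_fun1_square: "(\<integral>\<^sup>+t. ennreal ((hermite_fun1 k t)\<^sup>2) \<partial>lborel) = 1"
proof -
  let ?c = "2 ^ k * fact k * sqrt pi :: real"
  have c: "0 < ?c" by simp
  have "(?c powr (- 1 / 2))\<^sup>2 = inverse ?c"
  proof -
    have "(?c powr (- 1 / 2))\<^sup>2 = ?c powr (- 1 / 2 + - 1 / 2)"
      unfolding power2_eq_square by (rule powr_add[symmetric])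
    also have "\<dots> = inverse ?c" using c by (simp add: powr_minus)
    finally show ?thesis .
  qed
  then have eq: "(hermite_fun1 k t)\<^sup>2 = inverse ?c * (hermite_rec k t * hermite_rec k t * exp (- t\<^sup>2))" for t
    unfolding hermite_fun1_def hermite_poly_eq power_mult_distrib
    by (simp add: power2_eq_square mult_ac flip: exp_add)
  have "(\<integral>\<^sup>+t. ennreal ((hermite_fun1 k t)\<^sup>2) \<partial>lborel) = ennreal (LINT t|lborel. (hermite_fun1 k t)\<^sup>2)"
    unfolding eq using c
    by (intro nn_integral_eq_integral integrable_mult_right integrable_hermite_rec_product)
      (auto intro!: AE_I2 mult_nonneg_nonneg)
  also have "(LINT t|lborel. (hermite_fun1 k t)\<^sup>2) = 1"
    unfolding eq using c by (simp add: integral_hermite_rec_square del: inverse_mult_distrib)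
  finally show ?thesis by simp
qed

lemma hermite_fun1_bound: "\<exists>C\<ge>0. \<forall>t. \<bar>hermite_fun1 k t\<bar> \<le> C * exp (- (1 / 4) * t\<^sup>2)"
proof -
  \<comment> \<open>Growth rate 1/4 against the decay rate 1/2 in \<open>hermite_fun1\<close> leaves
    decay at rate 1/4.\<close>
  obtain C where C: "0 \<le> C" "\<And>t. \<bar>hermite_rec k t\<bar> \<le> C * exp (1 / 4 * t\<^sup>2)"
    using hermite_rec_bound[of "1 / 4" k] by auto
  let ?c = "(2 ^ k * fact k * sqrt pi :: real) powr (- 1 / 2)"
  have "\<bar>hermite_fun1 k t\<bar> \<le> ?c * C * exp (- (1 / 4) * t\<^sup>2)" for t
  proof -
    have "\<bar>hermite_fun1 k t\<bar> \<le> ?c * (C * exp (1 / 4 * t\<^sup>2)) * exp (- t\<^sup>2 / 2)"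
      unfolding hermite_fun1_def hermite_poly_eq abs_mult abs_exp_cancel using C
      by (intro mult_mono) auto
    also have "\<dots> = ?c * C * (exp (1 / 4 * t\<^sup>2) * exp (- t\<^sup>2 / 2))"
      by (simp only: mult_ac)
    also have "exp (1 / 4 * t\<^sup>2) * exp (- t\<^sup>2 / 2) = exp (- (1 / 4) * t\<^sup>2)"
      by (simp flip: exp_add)
    finally show ?thesis .
  qed
  then show ?thesis using C by (intro exI[of _ "?c * C"]) auto
qed

lemma nn_integral_hermite_fun1_powr:
  assumes "1 \<le> p"
  shows "(\<integral>\<^sup>+t. ennreal (\<bar>hermite_fun1 k t\<bar> powr p) \<partial>lborel) < \<infinity>"
proof -
  obtain C where C: "0 \<le> C" "\<And>t. \<bar>hermite_fun1 k t\<bar> \<le> C * exp (- (1 / 4) * t\<^sup>2)"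
    using hermite_fun1_bound by blast
  have "\<bar>hermite_fun1 k t\<bar> powr p \<le> C powr p * exp (- (1 / 4) * t\<^sup>2)" for t
  proof -
    have "\<bar>hermite_fun1 k t\<bar> powr p \<le> (C * exp (- (1 / 4) * t\<^sup>2)) powr p"
      using C assms by (intro powr_mono2) auto
    also have "\<dots> = C powr p * exp (- (1 / 4) * t\<^sup>2 * p)"
      using C by (subst powr_mult) (auto simp: exp_powr_real)
    \<comment> \<open>As p \<ge> 1, the p-th power of this Gaussian decays at least as fast as the
      Gaussian itself.\<close>
    also have "\<dots> \<le> C powr p * exp (- (1 / 4) * t\<^sup>2)"
      using mult_left_mono[OF assms, of "t\<^sup>2"] by (intro mult_left_mono) auto
    finally show ?thesis .
  qed
  then have "(\<integral>\<^sup>+t. ennreal (\<bar>hermite_fun1 k t\<bar> powr p) \<partial>lborel) \<le>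
      (\<integral>\<^sup>+t. ennreal (C powr p * exp (- (1 / 4) * t\<^sup>2)) \<partial>lborel)"
    by (intro nn_integral_mono ennreal_leI)
  also have "\<dots> < \<infinity>"
  proof -
    have "integrable lborel (\<lambda>t. C powr p * exp (- (1 / 4) * t\<^sup>2))"
      using has_bochner_integral_gaussian[of "1 / 4"]
      by (intro integrable_mult_right) (auto simp: has_bochner_integral_iff)
    then show ?thesis by (subst nn_integral_eq_integral) auto
  qed
  finally show ?thesis .
qed

section \<open>Hermite functions on R^n\<close>

lemma nn_integral_lborel_vec_prod:
  fixes f :: "'n::finite \<Rightarrow> real \<Rightarrow> ennreal"
  assumes [measurable]: "\<And>j. f j \<in> borel_measurable borel"
  shows "(\<integral>\<^sup>+x. (\<Prod>j\<in>UNIV. f j (x $ j)) \<partial>(lborel :: (real ^ 'n) measure)) = (\<Prod>j\<in>UNIV. \<integral>\<^sup>+t. f j t \<partial>lborel)"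
proof -
  have Basis: "(Basis :: (real ^ 'n) set) = (\<lambda>j. axis j 1) ` UNIV"
    by (auto simp: Basis_vec_def)
  have inj: "inj (\<lambda>j::'n. axis j (1::real))" by (auto simp: inj_on_def axis_eq_axis)
  \<comment> \<open>\<open>nn_integral_lborel_prod\<close> takes its product over
    \<open>Basis\<close>; the basis vectors \<open>axis j 1\<close> are exchanged for the indices j,
    with \<open>axis_index\<close> as the way back.\<close>
  have reindex: "(\<Prod>b\<in>(Basis :: (real ^ 'n) set). g b) = (\<Prod>j\<in>UNIV. g (axis j 1))" for g :: "_ \<Rightarrow> ennreal"
    unfolding Basis by (subst prod.reindex[OF inj]) simp
  have "(\<integral>\<^sup>+x. (\<Prod>b\<in>Basis. f (axis_index b) (x \<bullet> b)) \<partial>(lborel :: (real ^ 'n) measure)) =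
      (\<Prod>b\<in>(Basis :: (real ^ 'n) set). \<integral>\<^sup>+t. f (axis_index b) t \<partial>lborel)"
    by (rule nn_integral_lborel_prod) auto
  then show ?thesis by (simp add: reindex inner_axis)
qed

lemma hermite_fun_measurable [measurable]:
  "hermite_fun (\<nu> :: nat ^ 'n::finite) \<in> borel_measurable borel"
proof -
  have "(\<lambda>x. \<Prod>j\<in>UNIV. hermite_fun1 (\<nu> $ j) (x $ j)) \<in> borel_measurable (borel :: (real ^ 'n) measure)"
    by (intro borel_measurable_prod measurable_compose[OF _ hermite_fun1_measurable]
        borel_measurable_continuous_onI continuous_intros)
  then show ?thesis unfolding hermite_fun_def[abs_def] by measurable
qed

lemma hermite_fun_in_Lp_real:
  assumes "1 \<le> p"
  shows "hermite_fun (\<nu> :: nat ^ 'n::finite) \<in> Lp_carrier (ennreal p)"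
proof -
  have "cmod (hermite_fun \<nu> x) powr p = (\<Prod>j\<in>UNIV. \<bar>hermite_fun1 (\<nu> $ j) (x $ j)\<bar> powr p)" for x
    unfolding hermite_fun_def norm_of_real by (simp add: abs_prod prod_powr_distrib)
  then have "(\<integral>\<^sup>+x. ennreal (cmod (hermite_fun \<nu> x) powr p) \<partial>(lborel :: (real ^ 'n) measure)) =
     (\<integral>\<^sup>+x. (\<Prod>j\<in>UNIV. ennreal (\<bar>hermite_fun1 (\<nu> $ j) (x $ j)\<bar> powr p)) \<partial>(lborel :: (real ^ 'n) measure))"
    by (simp add: prod_ennreal)
  also have "\<dots> = (\<Prod>j\<in>UNIV. \<integral>\<^sup>+t. ennreal (\<bar>hermite_fun1 (\<nu> $ j) t\<bar> powr p) \<partial>lborel)"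
    by (rule nn_integral_lborel_vec_prod) measurable
  also have "\<dots> < \<infinity>"
  proof -
    have "(\<integral>\<^sup>+t. ennreal (\<bar>hermite_fun1 k t\<bar> powr p) \<partial>lborel) \<noteq> top" for k
      using nn_integral_hermite_fun1_powr[OF assms, of k] by auto
    then show ?thesis unfolding infinity_ennreal_def less_top[symmetric] ennreal_prod_eq_top by simp
  qed
  finally show ?thesis using assms by (simp add: Lp_carrier_def)
qed

lemma hermite_fun_in_Lp_infinity: "hermite_fun (\<nu> :: nat ^ 'n::finite) \<in> Lp_carrier \<infinity>"
proof -
  have "\<forall>k. \<exists>C. \<forall>t. \<bar>hermite_fun1 k t\<bar> \<le> C"
  proof
    fix k
    obtain C where C: "0 \<le> C" "\<And>t. \<bar>hermite_fun1 k t\<bar> \<le> C * exp (- (1 / 4) * t\<^sup>2)"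
      using hermite_fun1_bound by blast
    have "C * exp (- (1 / 4) * t\<^sup>2) \<le> C * 1" for t using C(1) by (intro mult_left_mono) auto
    then show "\<exists>C. \<forall>t. \<bar>hermite_fun1 k t\<bar> \<le> C" using C(2) by (metis mult.right_neutral order_trans)
  qed
  then obtain C where C: "\<And>k t. \<bar>hermite_fun1 k t\<bar> \<le> C k" by metis
  have "cmod (hermite_fun \<nu> x) \<le> (\<Prod>j\<in>UNIV. C (\<nu> $ j))" for x
    unfolding hermite_fun_def norm_of_real abs_prod by (intro prod_mono conjI C) auto
  then have "esssup lborel (\<lambda>x. ennreal (cmod (hermite_fun \<nu> x))) \<le> ennreal (\<Prod>j\<in>UNIV. C (\<nu> $ j))"
    by (intro esssup_I) (auto intro!: AE_I2 ennreal_leI)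
  also have "\<dots> < \<infinity>" by simp
  finally show ?thesis by (simp add: Lp_carrier_def)
qed

lemma hermite_fun_in_Lp_conjugate:
  assumes "1 \<le> p" "1 / ennreal p + 1 / q = 1"
  shows "hermite_fun (\<nu> :: nat ^ 'n::finite) \<in> Lp_carrier q"
proof (cases "q = \<infinity>")
  case True
  then show ?thesis using hermite_fun_in_Lp_infinity by simp
next
  case False
  then obtain q' where "q = ennreal q'" "1 < q'" using conjugate_exponent_real[OF assms] by metis
  then show ?thesis using hermite_fun_in_Lp_real[of q'] by simp
qed

text \<open>Hermite functions are real, so their squares are nonnegative and integrate to the
  product of the one-variable normalisations. The integral of the modulus is recorded too, since
  both the absolute convergence of the diagonal series and the lower bound on products of norms call
  for it.\<close>

lemma hermite_fun_square_integral:
  "integrable lborel (\<lambda>x :: real ^ 'n::finite. (hermite_fun \<nu> x)\<^sup>2)"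
  "(LINT x|lborel. (hermite_fun \<nu> x)\<^sup>2) = 1"
  "(LINT x|lborel. cmod ((hermite_fun \<nu> x)\<^sup>2)) = 1"
proof -
  let ?h = "\<lambda>x. \<Prod>j\<in>UNIV. hermite_fun1 (\<nu> $ j) (x $ j)"
  have sq: "(hermite_fun \<nu> x)\<^sup>2 = complex_of_real ((?h x)\<^sup>2)" for x
    by (simp add: hermite_fun_def)
  have h[measurable]: "?h \<in> borel_measurable (borel :: (real ^ 'n) measure)"
    by (intro borel_measurable_prod measurable_compose[OF _ hermite_fun1_measurable]
        borel_measurable_continuous_onI continuous_intros)
  have "(\<integral>\<^sup>+x. ennreal ((?h x)\<^sup>2) \<partial>(lborel :: (real ^ 'n) measure)) =
     (\<integral>\<^sup>+x. (\<Prod>j\<in>UNIV. ennreal ((hermite_fun1 (\<nu> $ j) (x $ j))\<^sup>2)) \<partial>(lborel :: (real ^ 'n) measure))"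
    by (simp add: prod_ennreal prod_power_distrib)
  also have "\<dots> = (\<Prod>j\<in>UNIV. \<integral>\<^sup>+t. ennreal ((hermite_fun1 (\<nu> $ j) t)\<^sup>2) \<partial>lborel)"
    by (rule nn_integral_lborel_vec_prod) measurable
  finally have nn: "(\<integral>\<^sup>+x. ennreal ((?h x)\<^sup>2) \<partial>(lborel :: (real ^ 'n) measure)) = ennreal 1"
    by (simp add: nn_integral_hermite_fun1_square)
  have "has_bochner_integral lborel (\<lambda>x. (?h x)\<^sup>2) 1"
    by (rule has_bochner_integral_nn_integral[OF _ _ _ nn]) (auto intro!: AE_I2)
  then have *: "integrable lborel (\<lambda>x. (?h x)\<^sup>2)" "(LINT x|lborel. (?h x)\<^sup>2) = 1"
    by (auto simp: has_bochner_integral_iff)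
  show "integrable lborel (\<lambda>x :: real ^ 'n. (hermite_fun \<nu> x)\<^sup>2)"
    unfolding sq using * by (intro integrable_of_real)
  show "(LINT x|lborel. (hermite_fun \<nu> x)\<^sup>2) = 1"
    by (simp only: sq integral_complex_of_real *(2) of_real_1)
  show "(LINT x|lborel. cmod ((hermite_fun \<nu> x)\<^sup>2)) = 1"
    unfolding sq norm_of_real abs_power2 power2_abs by (rule *(2))
qed

section \<open>Nuclearity of Hermite multipliers\<close>

text \<open>T f is a pointwise \<open>suminf\<close>, whose value is arbitrary where the series
  diverges. Additivity and homogeneity are therefore obtained where the series converge absolutely,
  that is almost everywhere, which is linearity up to functions of seminorm 0.\<close>

lemma Lp_series_linear_operator:
  fixes e :: "nat \<Rightarrow> ('a::euclidean_space \<Rightarrow> complex) \<Rightarrow> complex" and y :: "nat \<Rightarrow> 'b::euclidean_space \<Rightarrow> complex"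
  assumes p: "1 \<le> p" "1 \<le> p'"
    and e: "\<And>i. e i \<in> dual_space (Lp (ennreal p))" and y: "\<And>i. y i \<in> Lp_carrier (ennreal p')"
    and sum: "summable (\<lambda>i. dual_norm (Lp (ennreal p)) (e i) * Lp_norm (ennreal p') (y i))"
  defines "T \<equiv> \<lambda>f x. \<Sum>i. e i f * y i x"
  shows "f \<in> Lp_carrier (ennreal p) \<Longrightarrow> AE x in lborel. summable (\<lambda>i. cmod (e i f * y i x))"
    and "f \<in> Lp_carrier (ennreal p) \<Longrightarrow>
      (\<lambda>k. Lp_norm (ennreal p') (\<lambda>x. T f x - (\<Sum>i<k. e i f * y i x))) \<longlonglongrightarrow> 0"
    and "linear_operator (Lp (ennreal p)) (Lp (ennreal p')) T"
proof -
  have term_Lp: "(\<lambda>x. e i f * y i x) \<in> Lp_carrier (ennreal p')" for i f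
    by (intro Lp_scale p y)
  have terms_summable: "summable (\<lambda>i. Lp_norm (ennreal p') (\<lambda>x. e i f * y i x))"
    if f: "f \<in> Lp_carrier (ennreal p)" for f
  proof (rule summable_comparison_test')
    show "summable (\<lambda>i. Lp_norm (ennreal p) f * (dual_norm (Lp (ennreal p)) (e i) * Lp_norm (ennreal p') (y i)))"
      by (intro summable_mult sum)
    fix i
    have "cmod (e i f) * Lp_norm (ennreal p') (y i) \<le>
        (dual_norm (Lp (ennreal p)) (e i) * Lp_norm (ennreal p) f) * Lp_norm (ennreal p') (y i)"
      by (intro mult_right_mono dual_bound p e f) simp
    then show "norm (Lp_norm (ennreal p') (\<lambda>x. e i f * y i x)) \<le>
        Lp_norm (ennreal p) f * (dual_norm (Lp (ennreal p)) (e i) * Lp_norm (ennreal p') (y i))"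
      by (simp add: Lp_scale(2)[OF p(2) y] mult_ac)
  qed
  note series = Lp_series[OF p(2) term_Lp terms_summable]
  show AE: "AE x in lborel. summable (\<lambda>i. cmod (e i f * y i x))" if "f \<in> Lp_carrier (ennreal p)" for f
    by (rule series(1)[OF that])
  show "(\<lambda>k. Lp_norm (ennreal p') (\<lambda>x. T f x - (\<Sum>i<k. e i f * y i x))) \<longlonglongrightarrow> 0"
    if "f \<in> Lp_carrier (ennreal p)" for f
    unfolding T_def by (rule Lp_series_tendsto[OF p(2) term_Lp terms_summable[OF that]])
  have TL: "T f \<in> Lp_carrier (ennreal p')" if "f \<in> Lp_carrier (ennreal p)" for f
    unfolding T_def by (rule series(2)[OF that])
  have Tm: "T f \<in> borel_measurable borel" if "f \<in> Lp_carrier (ennreal p)" for f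
    using TL[OF that] by (rule Lp_carrier_measurable)
  \<comment> \<open>T f depends on f only through the numbers e_i(f), so equivalent arguments have
    images equal at every point.\<close>
  have same: "T f = T g" if "f \<in> Lp_carrier (ennreal p)" "g \<in> Lp_carrier (ennreal p)"
    "Lp_norm (ennreal p) (\<lambda>x. f x - g x) = 0" for f g
  proof -
    have "cmod (e i (\<lambda>x. f x - g x)) \<le> dual_norm (Lp (ennreal p)) (e i) * Lp_norm (ennreal p) (\<lambda>x. f x - g x)" for i
      by (intro dual_bound Lp_diff p e that)
    then have "e i f = e i g" for i using that by (simp add: dual_diff[OF p(1) e])
    then show ?thesis by (simp add: T_def)
  qed
  have add: "Lp_norm (ennreal p') (\<lambda>x. T (\<lambda>x. f x + g x) x - (T f x + T g x)) = 0"
    if f: "f \<in> Lp_carrier (ennreal p)" and g: "g \<in> Lp_carrier (ennreal p)" for f g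
  proof (rule Lp_norm_AE_0[OF p(2)])
    have [measurable]: "T (\<lambda>x. f x + g x) \<in> borel_measurable borel" "T f \<in> borel_measurable borel" "T g \<in> borel_measurable borel"
      by (intro Tm Lp_triangle p f g)+
    show "(\<lambda>x. T (\<lambda>x. f x + g x) x - (T f x + T g x)) \<in> borel_measurable borel" by measurable
    show "AE x in lborel. T (\<lambda>x. f x + g x) x - (T f x + T g x) = 0"
      using AE[OF f] AE[OF g]
    proof eventually_elim
      case (elim x)
      then show ?case
        using suminf_add[OF summable_norm_cancel[OF elim(1)] summable_norm_cancel[OF elim(2)]] f g
        by (simp add: T_def dual_space_add[OF e] distrib_right)
    qed
  qed
  have scale: "Lp_norm (ennreal p') (\<lambda>x. T (\<lambda>x. c * f x) x - c * T f x) = 0"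
    if f: "f \<in> Lp_carrier (ennreal p)" for f c
  proof (rule Lp_norm_AE_0[OF p(2)])
    have [measurable]: "T (\<lambda>x. c * f x) \<in> borel_measurable borel" "T f \<in> borel_measurable borel"
      by (intro Tm Lp_scale p f)+
    show "(\<lambda>x. T (\<lambda>x. c * f x) x - c * T f x) \<in> borel_measurable borel" by measurable
    show "AE x in lborel. T (\<lambda>x. c * f x) x - c * T f x = 0"
      using AE[OF f]
    proof eventually_elim
      case (elim x)
      then show ?case
        using suminf_mult[OF summable_norm_cancel[OF elim], of c] f
        by (simp add: T_def dual_space_scale[OF e] mult.assoc)
    qed
  qed
  show "linear_operator (Lp (ennreal p)) (Lp (ennreal p')) T"
    unfolding linear_operator_def same_vec_def Lp_sel
  proof (intro conjI ballI allI impI TL add scale)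
    fix f g :: "'a \<Rightarrow> complex"
    assume "f \<in> Lp_carrier (ennreal p)" "g \<in> Lp_carrier (ennreal p)" "Lp_norm (ennreal p) (\<lambda>x. f x - g x) = 0"
    then have "T f = T g" by (rule same)
    then show "Lp_norm (ennreal p') (\<lambda>x. T f x - T g x) = 0"
      by (simp add: Lp_norm_AE_0[OF p(2)])
  qed
qed

section \<open>Unordered sums along an enumeration\<close>

lemma summable_on_iff_summable_enum:
  fixes g :: "'a \<Rightarrow> complex" and en :: "nat \<Rightarrow> 'a"
  assumes "bij en"
  shows "g summable_on UNIV \<longleftrightarrow> summable (\<lambda>i. cmod (g (en i)))"
proof -
  have "g summable_on UNIV \<longleftrightarrow> (\<lambda>x. cmod (g x)) summable_on UNIV"
    by (rule summable_on_iff_abs_summable_on_complex)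
  also have "\<dots> \<longleftrightarrow> (\<lambda>i. cmod (g (en i))) summable_on UNIV"
    by (rule summable_on_reindex_bij_betw[symmetric]) (use assms in simp)
  also have "\<dots> \<longleftrightarrow> summable (\<lambda>i. cmod (g (en i)))"
    by (rule summable_on_UNIV_nonneg_real_iff) simp
  finally show ?thesis .
qed

text \<open>The default value 0 is included so that the formula holds at every point; measurability
  of the diagonal sum as a function of x rests on this.\<close>

lemma infsum_eq_suminf_enum:
  fixes g :: "'a \<Rightarrow> complex" and en :: "nat \<Rightarrow> 'a"
  assumes "bij en"
  shows "infsum g UNIV = (if summable (\<lambda>i. cmod (g (en i))) then (\<Sum>i. g (en i)) else 0)"
proof (cases "summable (\<lambda>i. cmod (g (en i)))")
  case True
  have "infsum g UNIV = infsum (\<lambda>i. g (en i)) UNIV"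
    by (rule infsum_reindex_bij_betw[symmetric]) (use assms in simp)
  moreover have "(\<lambda>i. g (en i)) summable_on UNIV"
    using True by (rule norm_summable_imp_summable_on)
  then have "((\<lambda>i. g (en i)) has_sum infsum (\<lambda>i. g (en i)) UNIV) UNIV"
    by (rule has_sum_infsum)
  then have "(\<lambda>i. g (en i)) sums infsum (\<lambda>i. g (en i)) UNIV"
    by (rule has_sum_imp_sums)
  ultimately show ?thesis using True by (simp add: sums_unique)
next
  case False
  then show ?thesis using summable_on_iff_summable_enum[OF assms, of g] by (simp add: infsum_not_exists)
qed

text \<open>Summability of nonnegative reals is finiteness of their sum in \<open>ennreal\<close>,
  and that sum is a measurable function.\<close>

lemma pred_summable_measurable:
  fixes g :: "nat \<Rightarrow> 'a \<Rightarrow> complex"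
  assumes [measurable]: "\<And>i. g i \<in> borel_measurable M"
  shows "Measurable.pred M (\<lambda>x. summable (\<lambda>i. cmod (g i x)))"
proof -
  have "summable (\<lambda>i. cmod (g i x)) \<longleftrightarrow> (\<Sum>i. ennreal (cmod (g i x))) \<noteq> top" for x
  proof
    show "(\<Sum>i. ennreal (cmod (g i x))) \<noteq> top" if "summable (\<lambda>i. cmod (g i x))"
      using that norm_ge_zero by (rule ennreal_suminf_neq_top)
  qed (rule summable_suminf_not_top[OF norm_ge_zero])
  then show ?thesis by simp
qed

lemma bij_enum_vec: "bij (from_nat_into (UNIV :: (nat ^ 'n::finite) set))"
proof -
  \<comment> \<open>The constant vectors already form infinitely many multi-indices, the index type
    being nonempty.\<close>
  have "inj (\<lambda>k. (\<chi> j. k) :: nat ^ 'n)" by (auto simp: inj_on_def vec_eq_iff)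
  then have "infinite (UNIV :: (nat ^ 'n) set)"
    using finite_subset[of "range (\<lambda>k. (\<chi> j. k) :: nat ^ 'n)" UNIV] finite_imageD by auto
  then show ?thesis using bij_betw_from_nat_into[of "UNIV :: (nat ^ 'n) set"] by simp
qed

lemma infsum_ennreal_finite_summable:
  assumes "\<And>x. 0 \<le> f x" "(\<Sum>\<^sub>\<infinity>x. ennreal (f x)) < \<infinity>"
  shows "f summable_on UNIV"
proof (rule nonneg_bdd_above_summable_on)
  obtain C where C: "(\<Sum>\<^sub>\<infinity>x. ennreal (f x)) = ennreal C" "0 \<le> C"
    using assms(2) by (cases "\<Sum>\<^sub>\<infinity>x. ennreal (f x)") auto
  show "bdd_above (sum f ` {F. F \<subseteq> UNIV \<and> finite F})"
  proof (intro bdd_aboveI2)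
    fix F :: "'a set" assume F: "F \<in> {F. F \<subseteq> UNIV \<and> finite F}"
    have "ennreal (sum f F) = (\<Sum>x\<in>F. ennreal (f x))" using assms(1) by (simp add: sum_ennreal)
    also have "\<dots> \<le> (\<Sum>\<^sub>\<infinity>x. ennreal (f x))"
      using F by (subst nonneg_infsum_complete) (auto intro!: SUP_upper)
    finally show "sum f F \<le> C" using C by simp
  qed
qed (use assms in auto)

section \<open>Test functions and Hermite coefficients\<close>

lemma test_functions_in_Lp:
  fixes f :: "real ^ 'n::finite \<Rightarrow> complex"
  assumes "1 \<le> p" "f \<in> test_functions"
  shows "f \<in> Lp_carrier (ennreal p)"
proof -
  let ?K = "closure {x. f x \<noteq> 0}"
  have K: "compact ?K" and "differentiable_upto 0 f" using assms(2) by (auto simp: test_functions_def)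
  then have cont: "continuous_on UNIV f" by simp
  then have [measurable]: "f \<in> borel_measurable borel" by (rule borel_measurable_continuous_onI)
  have "bounded (f ` ?K)"
    using K cont by (intro compact_imp_bounded compact_continuous_image) (auto intro: continuous_on_subset)
  then obtain B where B: "\<And>x. x \<in> ?K \<Longrightarrow> cmod (f x) \<le> B" by (auto simp: bounded_iff)
  have fin: "emeasure lborel ?K < \<infinity>" by (rule emeasure_compact_finite[OF K])
  have "integrable lborel (\<lambda>x. \<bar>B\<bar> powr p * indicator ?K x)"
    using fin by (intro integrable_mult_right integrable_real_indicator) auto
  then have "integrable lborel (\<lambda>x. cmod (f x) powr p)"
  proof (rule Bochner_Integration.integrable_bound)
    show "AE x in lborel. norm (cmod (f x) powr p) \<le> norm (\<bar>B\<bar> powr p * indicator ?K x)"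
    proof (rule AE_I2)
      fix x
      show "norm (cmod (f x) powr p) \<le> norm (\<bar>B\<bar> powr p * indicator ?K x)"
      proof (cases "f x = 0")
        case False
        then have "x \<in> ?K" using closure_subset[of "{x. f x \<noteq> 0}"] by blast
        then show ?thesis using B[of x] assms(1) by (auto intro!: powr_mono2)
      qed (use assms(1) in auto)
    qed
  qed measurable
  then show ?thesis using assms(1) by (simp add: Lp_carrier_real_iff)
qed

lemma hermite_coeff_dual:
  assumes p: "1 \<le> p" and q: "1 / ennreal p + 1 / q = 1"
  shows "(\<lambda>f. c * hermite_coeff f \<nu>) \<in> dual_space (Lp (ennreal p) :: (real ^ 'n::finite) fun_space)"
    "dual_norm (Lp (ennreal p) :: (real ^ 'n) fun_space) (\<lambda>f. c * hermite_coeff f \<nu>) \<le>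
      cmod c * Lp_norm q (hermite_fun \<nu>)"
proof -
  note H = Holder[OF p q _ hermite_fun_in_Lp_conjugate[OF p q]]
  have bound: "cmod (c * hermite_coeff f \<nu>) \<le> cmod c * Lp_norm q (hermite_fun \<nu>) * Lp_norm (ennreal p) f"
    if "f \<in> Lp_carrier (ennreal p)" for f
    using mult_left_mono[OF H(3)[OF that, of \<nu>], of "cmod c"]
    by (simp add: hermite_coeff_def norm_mult mult_ac)
  show "(\<lambda>f. c * hermite_coeff f \<nu>) \<in> dual_space (Lp (ennreal p) :: (real ^ 'n) fun_space)"
    unfolding dual_space_def Lp_sel mem_Collect_eq
  proof (intro conjI ballI allI)
    fix f g :: "real ^ 'n \<Rightarrow> complex"
    assume fg: "f \<in> Lp_carrier (ennreal p)" "g \<in> Lp_carrier (ennreal p)"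
    show "c * hermite_coeff (\<lambda>x. f x + g x) \<nu> = c * hermite_coeff f \<nu> + c * hermite_coeff g \<nu>"
      unfolding hermite_coeff_def distrib_right
      by (simp add: Bochner_Integration.integral_add[OF H(1)[OF fg(1)] H(1)[OF fg(2)]] distrib_left)
  next
    fix d and f :: "real ^ 'n \<Rightarrow> complex"
    show "c * hermite_coeff (\<lambda>x. d * f x) \<nu> = d * (c * hermite_coeff f \<nu>)"
      by (simp add: hermite_coeff_def mult.assoc mult.left_commute)
  next
    show "\<exists>C. \<forall>f\<in>Lp_carrier (ennreal p). cmod (c * hermite_coeff f \<nu>) \<le> C * Lp_norm (ennreal p) f"
      using bound by blast
  qed
  show "dual_norm (Lp (ennreal p) :: (real ^ 'n) fun_space) (\<lambda>f. c * hermite_coeff f \<nu>) \<le>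
      cmod c * Lp_norm q (hermite_fun \<nu>)"
    by (rule dual_norm_le[OF p bound]) auto
qed

text \<open>Hoelder applied to \<phi> times itself, whose integral is 1. This bounds |m(\<nu>)| by
  |m(\<nu>)| times the product of norms, which makes m summable when the exponents agree.\<close>

lemma hermite_norm_product_ge_1:
  assumes p: "1 \<le> p" and q: "1 / ennreal p + 1 / q = 1"
  shows "1 \<le> Lp_norm (ennreal p) (hermite_fun \<nu>) * Lp_norm q (hermite_fun (\<nu> :: nat ^ 'n::finite))"
  using Holder(2)[OF p q hermite_fun_in_Lp_real[OF p] hermite_fun_in_Lp_conjugate[OF p q], of \<nu> \<nu>]
    hermite_fun_square_integral(3)[of \<nu>]
  by (simp add: power2_eq_square)

text \<open>The \<nu>-th term has L^1 norm exactly |m(\<nu>)|, so absolute summability of m gives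
  convergence almost everywhere by Tonelli and justifies integrating term by term.\<close>

lemma hermite_diagonal_sum:
  fixes m :: "nat ^ 'n::finite \<Rightarrow> complex"
  assumes "m summable_on UNIV"
  shows "AE x in lborel. (\<lambda>\<nu>. m \<nu> * (hermite_fun \<nu> x)\<^sup>2) summable_on UNIV"
    "integrable lborel (\<lambda>x. \<Sum>\<^sub>\<infinity>\<nu>. m \<nu> * (hermite_fun \<nu> x)\<^sup>2)"
    "(LINT x|lborel. (\<Sum>\<^sub>\<infinity>\<nu>. m \<nu> * (hermite_fun \<nu> x)\<^sup>2)) = (\<Sum>\<^sub>\<infinity>\<nu>. m \<nu>)"
proof -
  define en where "en = from_nat_into (UNIV :: (nat ^ 'n) set)"
  have en: "bij en" unfolding en_def by (rule bij_enum_vec)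
  define f where "f i x = m (en i) * (hermite_fun (en i) x)\<^sup>2" for i x
  have [measurable]: "f i \<in> borel_measurable borel" for i unfolding f_def by measurable
  have int: "integrable lborel (f i)" for i
    unfolding f_def by (intro integrable_mult_right hermite_fun_square_integral)
  have sum: "summable (\<lambda>i. cmod (m (en i)))"
    using assms summable_on_iff_summable_enum[OF en] by blast
  have norms: "(LINT x|lborel. cmod (f i x)) = cmod (m (en i))" for i
    unfolding f_def norm_mult[of "m (en i)"]
    by (simp only: integral_mult_right_zero hermite_fun_square_integral(3) mult_1_right)
  have "(\<integral>\<^sup>+x. (\<Sum>i. ennreal (cmod (f i x))) \<partial>lborel) = (\<Sum>i. \<integral>\<^sup>+x. ennreal (cmod (f i x)) \<partial>lborel)"
    by (rule nn_integral_suminf) measurable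
  also have "\<dots> = (\<Sum>i. ennreal (cmod (m (en i))))"
    using int by (simp add: nn_integral_eq_integral norms)
  also have "\<dots> \<noteq> \<infinity>" unfolding infinity_ennreal_def by (rule ennreal_suminf_neq_top[OF sum norm_ge_zero])
  finally have "AE x in lborel. (\<Sum>i. ennreal (cmod (f i x))) \<noteq> \<infinity>"
    by (intro nn_integral_PInf_AE) auto
  then have AE: "AE x in lborel. summable (\<lambda>i. cmod (f i x))"
    unfolding infinity_ennreal_def
    by eventually_elim (rule summable_suminf_not_top[OF norm_ge_zero])
  then show "AE x in lborel. (\<lambda>\<nu>. m \<nu> * (hermite_fun \<nu> x)\<^sup>2) summable_on UNIV"
    by (simp add: summable_on_iff_summable_enum[OF en] f_def)
  have sumnorm: "summable (\<lambda>i. LINT x|lborel. cmod (f i x))" using sum by (simp add: norms)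
  note series = integrable_suminf[OF int AE sumnorm] integral_suminf[OF int AE sumnorm]
  have inf: "(\<Sum>\<^sub>\<infinity>\<nu>. m \<nu> * (hermite_fun \<nu> x)\<^sup>2) = (if summable (\<lambda>i. cmod (f i x)) then (\<Sum>i. f i x) else 0)" for x
    using infsum_eq_suminf_enum[OF en, of "\<lambda>\<nu>. m \<nu> * (hermite_fun \<nu> x)\<^sup>2"] by (simp add: f_def)
  have [measurable]: "Measurable.pred borel (\<lambda>x. summable (\<lambda>i. cmod (f i x)))"
    by (rule pred_summable_measurable) measurable
  have meas: "(\<lambda>x. \<Sum>\<^sub>\<infinity>\<nu>. m \<nu> * (hermite_fun \<nu> x)\<^sup>2) \<in> borel_measurable lborel"
    unfolding inf by measurable
  have meas': "(\<lambda>x. \<Sum>i. f i x) \<in> borel_measurable lborel" by measurable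
  have eq: "AE x in lborel. (\<Sum>\<^sub>\<infinity>\<nu>. m \<nu> * (hermite_fun \<nu> x)\<^sup>2) = (\<Sum>i. f i x)"
    using AE by eventually_elim (simp add: inf)
  show "integrable lborel (\<lambda>x. \<Sum>\<^sub>\<infinity>\<nu>. m \<nu> * (hermite_fun \<nu> x)\<^sup>2)"
    using integrable_cong_AE[OF meas meas' eq] series(1) by simp
  have "(LINT x|lborel. (\<Sum>\<^sub>\<infinity>\<nu>. m \<nu> * (hermite_fun \<nu> x)\<^sup>2)) = (LINT x|lborel. (\<Sum>i. f i x))"
    by (rule integral_cong_AE[OF meas meas' eq])
  also have "\<dots> = (\<Sum>i. LINT x|lborel. f i x)" by (rule series(2))
  also have "\<dots> = (\<Sum>i. m (en i))"
    unfolding f_def by (simp add: hermite_fun_square_integral(2))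
  also have "\<dots> = (\<Sum>\<^sub>\<infinity>\<nu>. m \<nu>)"
    using infsum_eq_suminf_enum[OF en, of m] sum by simp
  finally show "(LINT x|lborel. (\<Sum>\<^sub>\<infinity>\<nu>. m \<nu> * (hermite_fun \<nu> x)\<^sup>2)) = (\<Sum>\<^sub>\<infinity>\<nu>. m \<nu>)" .
qed

theorem mainTheorem5:
  fixes m :: "nat ^ 'n::finite \<Rightarrow> complex"
    and p\<^sub>1 p\<^sub>2 r :: real and q\<^sub>1 :: ennreal
  assumes "1 \<le> p\<^sub>1" and "1 \<le> p\<^sub>2" and "0 < r" and "r \<le> 1"
    and "1 / ennreal p\<^sub>1 + 1 / q\<^sub>1 = 1"
    and "hermite_s r m (ennreal p\<^sub>2) q\<^sub>1 < \<infinity>"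
  shows "\<exists>T :: (real ^ 'n \<Rightarrow> complex) \<Rightarrow> (real ^ 'n \<Rightarrow> complex).
    extends_hermite_multiplier m T \<and>
    r_nuclear r (Lp (ennreal p\<^sub>1)) (Lp (ennreal p\<^sub>2)) T \<and>
    (p\<^sub>1 = p\<^sub>2 \<longrightarrow>
      m summable_on UNIV \<and>
      (AE x in lborel. (\<lambda>\<nu>. m \<nu> * (hermite_fun \<nu> x)\<^sup>2) summable_on UNIV) \<and>
      integrable lborel (\<lambda>x. \<Sum>\<^sub>\<infinity>\<nu>. m \<nu> * (hermite_fun \<nu> x)\<^sup>2) \<and>
      nuclear_trace r (Lp (ennreal p\<^sub>1)) T = (LINT x|lborel. (\<Sum>\<^sub>\<infinity>\<nu>. m \<nu> * (hermite_fun \<nu> x)\<^sup>2)) \<and>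
      (LINT x|lborel. (\<Sum>\<^sub>\<infinity>\<nu>. m \<nu> * (hermite_fun \<nu> x)\<^sup>2)) = (\<Sum>\<^sub>\<infinity>\<nu>. m \<nu>))"
proof -
  note p = assms(1,2) and r = assms(3,4) and q = assms(5)
  define en where "en = from_nat_into (UNIV :: (nat ^ 'n) set)"
  have en: "bij en" unfolding en_def by (rule bij_enum_vec)
  define e where "e i f = m (en i) * hermite_coeff f (en i)" for i and f :: "real ^ 'n \<Rightarrow> complex"
  define y where "y i = hermite_fun (en i)" for i
  define T where "T f x = (\<Sum>i. e i f * y i x)" for f x
  \<comment> \<open>The power \<open>a i powr r\<close> is the term of \<open>hermite_s\<close> at
    \<open>en i\<close>, while \<open>a i\<close> itself dominates the product of the norms of
    \<open>e i\<close> and \<open>y i\<close>.\<close>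
  define a where "a i = cmod (m (en i)) * Lp_norm q\<^sub>1 (y i) * Lp_norm (ennreal p\<^sub>2) (y i)" for i
  let ?D = "dual_norm (Lp (ennreal p\<^sub>1) :: (real ^ 'n) fun_space)"
  have e: "e i \<in> dual_space (Lp (ennreal p\<^sub>1))" "?D (e i) \<le> cmod (m (en i)) * Lp_norm q\<^sub>1 (y i)" for i
    unfolding e_def[abs_def] y_def by (rule hermite_coeff_dual[OF p(1) q])+
  have y: "y i \<in> Lp_carrier (ennreal p\<^sub>2)" for i
    unfolding y_def by (rule hermite_fun_in_Lp_real[OF p(2)])
  have a0: "0 \<le> a i" for i by (simp add: a_def)
  have D0: "0 \<le> ?D (e i)" for i by (rule dual_norm_nonneg[OF p(1) e(1)])
  have le: "?D (e i) * Lp_norm (ennreal p\<^sub>2) (y i) \<le> a i" for i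
    unfolding a_def by (intro mult_right_mono e) simp
  have "(\<lambda>\<nu>. cmod (m \<nu>) powr r * Lp_norm (ennreal p\<^sub>2) (hermite_fun \<nu>) powr r
       * Lp_norm q\<^sub>1 (hermite_fun \<nu>) powr r) summable_on UNIV"
    by (rule infsum_ennreal_finite_summable) (use assms(6) in \<open>auto simp: hermite_s_def\<close>)
  then have "(\<lambda>i. cmod (m (en i)) powr r * Lp_norm (ennreal p\<^sub>2) (y i) powr r * Lp_norm q\<^sub>1 (y i) powr r) summable_on UNIV"
    unfolding y_def by (subst summable_on_reindex_bij_betw[OF en])
  then have "summable (\<lambda>i. cmod (m (en i)) powr r * Lp_norm (ennreal p\<^sub>2) (y i) powr r * Lp_norm q\<^sub>1 (y i) powr r)"
    by (rule summable_on_imp_summable)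
  then have sum_r: "summable (\<lambda>i. a i powr r)"
    by (simp add: a_def powr_mult mult_ac)
  then have sum_a: "summable a"
    by (rule summable_of_summable_powr[OF r a0])
  have sum: "summable (\<lambda>i. ?D (e i) * Lp_norm (ennreal p\<^sub>2) (y i))"
    by (rule summable_comparison_test'[OF sum_a]) (use le D0 in simp)
  note series = Lp_series_linear_operator[OF p e(1) y sum, folded T_def]
  have T: "linear_operator (Lp (ennreal p\<^sub>1)) (Lp (ennreal p\<^sub>2)) T"
    using series(3) unfolding T_def[abs_def] .
  have rep: "nuclear_rep r (Lp (ennreal p\<^sub>1)) (Lp (ennreal p\<^sub>2)) T e y"
    unfolding nuclear_rep_def Lp_sel
  proof (intro conjI allI ballI e(1) y series(2))
    have "norm (?D (e i) powr r * Lp_norm (ennreal p\<^sub>2) (y i) powr r) \<le> a i powr r" for i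
      using powr_mono2[OF _ _ le, of r i] r D0[of i] by (simp add: powr_mult)
    then show "summable (\<lambda>i. ?D (e i) powr r * Lp_norm (ennreal p\<^sub>2) (y i) powr r)"
      by (intro summable_comparison_test'[OF sum_r])
  qed
  have ext: "extends_hermite_multiplier m T"
    unfolding extends_hermite_multiplier_def
  proof
    fix f :: "real ^ 'n \<Rightarrow> complex" assume "f \<in> test_functions"
    then have f: "f \<in> Lp_carrier (ennreal p\<^sub>1)" by (rule test_functions_in_Lp[OF p(1)])
    show "AE x in lborel. (\<lambda>\<nu>. m \<nu> * hermite_coeff f \<nu> * hermite_fun \<nu> x) summable_on UNIV \<and>
        T f x = hermite_multiplier m f x"
      using series(1)[OF f]
    proof eventually_elim
      case (elim x)
      then have "summable (\<lambda>i. cmod (m (en i) * hermite_coeff f (en i) * hermite_fun (en i) x))"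
        by (simp add: e_def y_def)
      then show ?case
        using summable_on_iff_summable_enum[OF en, of "\<lambda>\<nu>. m \<nu> * hermite_coeff f \<nu> * hermite_fun \<nu> x"]
          infsum_eq_suminf_enum[OF en, of "\<lambda>\<nu>. m \<nu> * hermite_coeff f \<nu> * hermite_fun \<nu> x"]
        by (simp add: T_def e_def y_def hermite_multiplier_def)
    qed
  qed
  have trace: "m summable_on UNIV \<and> nuclear_trace r (Lp (ennreal p\<^sub>1)) T = (\<Sum>\<^sub>\<infinity>\<nu>. m \<nu>)" if eq: "p\<^sub>1 = p\<^sub>2"
  proof -
    have "cmod (m (en i)) \<le> a i" for i
      using mult_left_mono[OF hermite_norm_product_ge_1[OF p(1) q, of "en i"], of "cmod (m (en i))"] eq
      by (simp add: a_def y_def mult_ac)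
    then have sum_m: "summable (\<lambda>i. cmod (m (en i)))"
      by (intro summable_comparison_test'[OF sum_a]) simp
    have "e i (y i) = m (en i)" for i
      using hermite_fun_square_integral(2)[of "en i"]
      by (simp add: e_def y_def hermite_coeff_def power2_eq_square)
    moreover have "(\<lambda>i. m (en i)) sums (\<Sum>\<^sub>\<infinity>\<nu>. m \<nu>)"
      using infsum_eq_suminf_enum[OF en, of m] sum_m summable_sums[OF summable_norm_cancel[OF sum_m]] by simp
    ultimately have "(\<lambda>i. e i (y i)) sums (\<Sum>\<^sub>\<infinity>\<nu>. m \<nu>)" by simp
    then have "nuclear_trace r (Lp (ennreal p\<^sub>1)) T = (\<Sum>\<^sub>\<infinity>\<nu>. m \<nu>)"
      using nuclear_trace_eqI[OF p(1) r] T rep eq by blast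
    then show ?thesis using sum_m summable_on_iff_summable_enum[OF en, of m] by blast
  qed
  show ?thesis
  proof (intro exI[of _ T] conjI impI)
    show "r_nuclear r (Lp (ennreal p\<^sub>1)) (Lp (ennreal p\<^sub>2)) T"
      using T rep by (auto simp: r_nuclear_def)
  qed (use ext trace hermite_diagonal_sum[of m] in auto)
qed

end
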